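(* Let $p_-<0<p_+$ and $\lambda_-,\lambda_+>0$ with $\frac{\lambda_+}{p_+}<-\frac{\lambda_-}{p_-}$. Let $(X,E)$ be the piecewise deterministic Markov process on $[0,\infty)\times I$, $I=\{-1,1\}$, obtained by switching between $f_{-1}(x)=p_-x-x^2$ and $f_1(x)=p_+x-x^2$ on $[0,\infty)$, with rate $\lambda_-$ of switching from $f_{-1}$ to $f_1$ and rate $\lambda_+$ of switching from $f_1$ to $f_{-1}$. Then the ergodic invariant probability measure $\mu$ of $(X,E)$ with $\mu((0,\infty)\times I)=1$ is absolutely continuous with respect to the product of Lebesgue measure and counting measure on $I$, and the corresponding invariant density $\rho=(\rho_i)_{i\in I}$ is given, for $i\in I$, by $$\rho_i(x)=C\,x^{-\frac{\lambda_-}{p_-}-\frac{\lambda_+}{p_+}-1}\,(-p_-+x)^{\frac{\lambda_-}{p_-}-\frac12(1-i)}\,(p_+-x)^{\frac{\lambda_+}{p_+}-\frac12(1+i)}\,\mathbf{1}_{(0,p_+)}(x),$$ where $C$ is a normalizing constant (the same for $i=-1$ and $i=1$).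
   Context: The process $(X,E)$: $E=(E_t)_{t\ge0}$ is the continuous-time Markov chain on $I=\{-1,1\}$ that jumps from $-1$ to $1$ at rate $\lambda_-$ and from $1$ to $-1$ at rate $\lambda_+$ (rates independent of $X$), and $X$ solves $X_t=X_0+\int_0^t f_{E_s}(X_s)\,ds$. The state space is restricted to $[0,\infty)\times I$; the set $[0,\infty)$ is positively invariant for both flows and both vector fields are forward complete there. $(X,E)$ is a Markov process with semigroup $(\mathsf{P}^t)$. An invariant probability measure (IPM) is a probability measure $\mu$ on the state space with $\mu\mathsf{P}^t=\mu$ for all $t\ge0$. An IPM $\nu$ is ergodic if $\nu(A)\in\{0,1\}$ for every measurable set $A$ of the state space such that for all $t\ge0$, $\mathsf{P}^t_z(A)=1$ for $\nu$-almost every $z\in A$. Under the assumption $\frac{\lambda_+}{p_+}<-\frac{\lambda_-}{p_-}$ there is exactly one ergodic IPM $\mu$ with $\mu((0,\infty)\times I)=1$. If an IPM is absolutely continuous with density $\rho(x,i)$, its invariant densities are $\rho_i=\rho(\cdot,i)$, $i\in I$. The right-hand side of the formula is understood to be $0$ for $x\notin(0,p_+)$, and densities are determined up to Lebesgue-null sets. *)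

theory Defs
  imports "HOL-Probability.Probability"
begin

text \<open>Random switching on the half-line between two vector fields \<open>f (-1)\<close> and \<open>f 1\<close>;
  \<open>r i\<close> is the rate at which the environment leaves the state \<open>i\<close>.\<close>

definition env_states :: "int set" where
  "env_states = {-1, 1}"

definition state_space :: "(real \<times> int) measure" where
  "state_space = restrict_space borel {0..} \<Otimes>\<^sub>M count_space env_states"

definition reference_measure :: "(real \<times> int) measure" where
  "reference_measure = restrict_space lborel {0..} \<Otimes>\<^sub>M count_space env_states"

text \<open>Law of the successive holding times of the environment chain started in \<open>i\<close>: they are
  independent, and the \<open>n\<close>-th one is spent in the state \<open>i * (-1) ^ n\<close>.\<close>

definition holding_times :: "(int \<Rightarrow> real) \<Rightarrow> int \<Rightarrow> (nat \<Rightarrow> real) measure" where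
  "holding_times r i =
     (\<Pi>\<^sub>M n\<in>UNIV. density lborel (\<lambda>s. ennreal (exponential_density (r (i * (-1) ^ n)) s)))"

definition jump_time :: "(nat \<Rightarrow> real) \<Rightarrow> nat \<Rightarrow> real" where
  "jump_time \<omega> n = (\<Sum>k<n. \<omega> k)"

definition regular_times :: "(nat \<Rightarrow> real) \<Rightarrow> bool" where
  "regular_times \<omega> \<longleftrightarrow>
     (\<forall>n. 0 < \<omega> n) \<and> filterlim (jump_time \<omega>) at_top sequentially"

text \<open>The environment at time \<open>t\<close>, obtained by counting the jumps up to time \<open>t\<close>. Holding
  times that are nonpositive or accumulate form a null set; there the chain is frozen, so that
  the process below is defined and measurable on the whole sample space.\<close>

definition environment :: "int \<Rightarrow> (nat \<Rightarrow> real) \<Rightarrow> real \<Rightarrow> int" where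
  "environment i \<omega> t =
     (if regular_times \<omega> then i * (-1) ^ card {n. jump_time \<omega> (Suc n) \<le> t} else i)"

text \<open>A function \<open>X\<close> with \<open>X t = x + \<integral>\<^sub>0\<^sup>t f (e s) (X s) ds\<close> for all \<open>t \<ge> 0\<close>. When such a solution
  is unique on the half-line, the choice operator only affects the irrelevant values at
  negative times.\<close>

definition switched_path ::
    "(int \<Rightarrow> real \<Rightarrow> real) \<Rightarrow> real \<Rightarrow> (real \<Rightarrow> int) \<Rightarrow> real \<Rightarrow> real" where
  "switched_path f x e =
     (SOME X. \<forall>t\<ge>0. ((\<lambda>s. f (e s) (X s)) has_integral (X t - x)) {0..t})"

definition pdmp_kernel ::
    "(int \<Rightarrow> real \<Rightarrow> real) \<Rightarrow> (int \<Rightarrow> real) \<Rightarrow> real \<Rightarrow> real \<times> int \<Rightarrow> (real \<times> int) measure" where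
  "pdmp_kernel f r t z =
     distr (holding_times r (snd z)) state_space
       (\<lambda>\<omega>. (switched_path f (fst z) (environment (snd z) \<omega>) t, environment (snd z) \<omega> t))"

definition invariant_prob ::
    "(int \<Rightarrow> real \<Rightarrow> real) \<Rightarrow> (int \<Rightarrow> real) \<Rightarrow> (real \<times> int) measure \<Rightarrow> bool" where
  "invariant_prob f r \<mu> \<longleftrightarrow>
     prob_space \<mu> \<and> sets \<mu> = sets state_space \<and>
     (\<forall>t\<ge>0. \<forall>A\<in>sets state_space.
        (\<integral>\<^sup>+ z. emeasure (pdmp_kernel f r t z) A \<partial>\<mu>) = emeasure \<mu> A)"

definition ergodic_invariant_prob ::
    "(int \<Rightarrow> real \<Rightarrow> real) \<Rightarrow> (int \<Rightarrow> real) \<Rightarrow> (real \<times> int) measure \<Rightarrow> bool" where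
  "ergodic_invariant_prob f r \<mu> \<longleftrightarrow>
     invariant_prob f r \<mu> \<and>
     (\<forall>A\<in>sets state_space.
        (\<forall>t\<ge>0. AE z in \<mu>. z \<in> A \<longrightarrow> emeasure (pdmp_kernel f r t z) A = 1) \<longrightarrow>
        emeasure \<mu> A = 0 \<or> emeasure \<mu> A = 1)"

definition logistic_field :: "real \<Rightarrow> real \<Rightarrow> int \<Rightarrow> real \<Rightarrow> real" where
  "logistic_field p\<^sub>m p\<^sub>p i x = (if i = 1 then p\<^sub>p else p\<^sub>m) * x - x\<^sup>2"

definition switch_rate :: "real \<Rightarrow> real \<Rightarrow> int \<Rightarrow> real" where
  "switch_rate l\<^sub>m l\<^sub>p i = (if i = 1 then l\<^sub>p else l\<^sub>m)"

end

theory Submission imports Defs begin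

text \<open>
  Ergodicity is not needed: every invariant probability measure carried by the open half-line is
  found by testing with the generator. Expanding the semigroup to first order in time on \<open>C\<^sup>1\<close>
  functions \<open>g\<close> turns invariance into
  \<open>\<Sum>\<^sub>i \<integral> f\<^sub>i g\<^sub>i' + r\<^sub>i (g\<^sub>-\<^sub>i - g\<^sub>i) d\<mu>\<^sub>i = 0\<close>. Taking \<open>g\<close> independent of \<open>i\<close> yields the flux balance
  \<open>f\<^sub>1 \<mu>\<^sub>1 + f\<^sub>-\<^sub>1 \<mu>\<^sub>-\<^sub>1 = 0\<close>; both fields are negative beyond \<open>p\<^sub>+\<close>, so there is no mass there, and bump
  functions exclude an atom at \<open>p\<^sub>+\<close>. On \<open>(0, p\<^sub>+)\<close> let \<open>W' = r\<^sub>1 / f\<^sub>1 + r\<^sub>-\<^sub>1 / f\<^sub>-\<^sub>1\<close>. Test functions with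
  \<open>g\<^sub>1 - g\<^sub>-\<^sub>1 = e\<^sup>W k\<close>, \<open>k\<close> compactly supported, and \<open>g\<^sub>-\<^sub>1\<close> chosen to cancel the contribution of
  \<open>\<mu>\<^sub>-\<^sub>1\<close> show that \<open>e\<^sup>W f\<^sub>1 \<mu>\<^sub>1\<close> annihilates all derivatives \<open>k'\<close>, hence is a multiple of
  Lebesgue measure; the flux balance then determines \<open>\<mu>\<^sub>-\<^sub>1\<close>.
\<close>

section \<open>The logistic equation with a time-dependent growth rate\<close>

text \<open>The weight \<open>W\<close> is read off the Fokker-Planck equation. If both densities
  were smooth, the flux \<open>J = f\<^sub>1 \<rho>\<^sub>1 = - f\<^sub>-\<^sub>1
  \<rho>\<^sub>-\<^sub>1\<close> would satisfy \<open>J' = - (r\<^sub>1 / f\<^sub>1 +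
  r\<^sub>-\<^sub>1 / f\<^sub>-\<^sub>1) J\<close>, so \<open>J\<close> would be a multiple of
  exp(-W). No regularity of the measure is known beforehand, hence the equation is used in dual
  form, with the integrating factor moved onto the test function. Two constraints shape the rest.
  The kernel is built on a choice of solution of the integral equation; everything about it
  therefore rests on an explicit solution formula, which also supplies measurability in the start
  and in the holding times. And the fields grow quadratically, so the test functions employed are
  bounded C^1 functions with compactly supported derivative; they may end in different constants on
  the two sides, which admits antiderivatives of arbitrary compactly supported functions. The
  separate argument at \<open>p\<^sub>p\<close> is forced because \<open>f\<^sub>1\<close> vanishes
  there: the flux cannot see an atom of \<open>\<mu>\<^sub>1\<close>.\<close>

definition log_growth :: "(real \<Rightarrow> real) \<Rightarrow> real \<Rightarrow> real" where
  "log_growth q t = (LINT s:{0..t}|lborel. q s)"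

text \<open>Solution of X' = q X - X^2 by the Bernoulli substitution: 1/X obeys the linear equation
  y' = 1 - q y. The fraction is cleared of 1/x, so that the rest point x = 0 is covered. The
  integrals are Lebesgue integrals, because measurability in a parameter of \<open>q\<close> is
  needed later.\<close>

definition logistic_path :: "(real \<Rightarrow> real) \<Rightarrow> real \<Rightarrow> real \<Rightarrow> real" where
  "logistic_path q x t =
     x * exp (log_growth q t) / (1 + x * (LINT s:{0..t}|lborel. exp (log_growth q s)))"

text \<open>The coefficient may jump, but only finitely often in bounded time. Off those times the
  solution formula can be differentiated classically, which is what the fundamental theorem with a
  finite exceptional set asks for. The bound serves integrability.\<close>

locale step_rate =
  fixes q :: "real \<Rightarrow> real" and B :: real
  assumes meas [measurable]: "q \<in> borel_measurable borel"
    and bound: "\<And>s. \<bar>q s\<bar> \<le> B"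
    and step: "\<And>T. \<exists>S. finite S \<and> (\<forall>s\<in>{0<..<T} - S. \<forall>\<^sub>F u in nhds s. q u = q s)"
begin

lemma set_integrable_rate: "set_integrable lborel {0..t} q"
proof -
  have "integrable lborel (\<lambda>s. indicator {0..t} s *\<^sub>R q s)"
    by (rule integrableI_bounded_set_indicator[where B = B]) (use bound in \<open>auto simp: emeasure_lborel_Icc_eq\<close>)
  then show ?thesis by (simp add: set_integrable_def)
qed

lemma rate_integrable_on: "q integrable_on {0..t}"
  using set_borel_integral_eq_integral(1)[OF set_integrable_rate] .

lemma log_growth_eq: "log_growth q t = integral {0..t} q"
  unfolding log_growth_def using set_borel_integral_eq_integral(2)[OF set_integrable_rate] .

lemma continuous_log_growth: "continuous_on {0..T} (log_growth q)"
  unfolding log_growth_eq[abs_def] by (rule indefinite_integral_continuous_1[OF rate_integrable_on])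

text \<open>An indefinite integral is differentiable wherever the integrand is continuous, and local
  constancy of \<open>q\<close> gives continuity at \<open>s\<close>.\<close>

lemma deriv_log_growth:
  assumes s: "0 < s" and ev: "\<forall>\<^sub>F u in nhds s. q u = q s"
  shows "(log_growth q has_real_derivative q s) (at s)"
proof -
  have "continuous (at s) q"
    unfolding isCont_def by (rule Lim_transform_eventually[OF tendsto_const[of "q s"]])
      (use ev in \<open>auto simp: eventually_at_filter elim!: eventually_mono\<close>)
  then have c: "continuous (at s within {0..s+1} - {}) q"
    by (rule continuous_at_imp_continuous_at_within)
  have "((\<lambda>u. integral {0..u} q) has_vector_derivative q s) (at s within {0..s+1} - {})"
    by (rule integral_has_vector_derivative_continuous_at[OF rate_integrable_on _ _ c]) (use s in auto)
  then have "((\<lambda>u. integral {0..u} q) has_vector_derivative q s) (at s)"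
    by (subst (asm) at_within_interior) (use s in \<open>auto simp: interior_atLeastAtMost_real\<close>)
  then show ?thesis
    unfolding log_growth_eq[abs_def] has_real_derivative_iff_has_vector_derivative .
qed

lemma set_integrable_exp: "set_integrable lborel {0..t} (\<lambda>s. exp (log_growth q s))"
  by (rule borel_integrable_atLeastAtMost')
     (intro continuous_intros continuous_log_growth)

abbreviation "Q \<equiv> \<lambda>t. LINT s:{0..t}|lborel. exp (log_growth q s)"

lemma Q_eq: "Q t = integral {0..t} (\<lambda>s. exp (log_growth q s))"
  using set_borel_integral_eq_integral(2)[OF set_integrable_exp] .

lemma continuous_Q: "continuous_on {0..T} Q"
  unfolding Q_eq[abs_def] by (rule indefinite_integral_continuous_1)
    (intro integrable_continuous_interval continuous_intros continuous_log_growth)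

lemma deriv_Q:
  assumes s: "0 < s"
  shows "(Q has_real_derivative exp (log_growth q s)) (at s)"
proof -
  have "((\<lambda>u. integral {0..u} (\<lambda>s. exp (log_growth q s))) has_real_derivative exp (log_growth q s)) (at s within {0..s+1})"
    by (rule integral_has_real_derivative)
       (use s in \<open>auto intro!: continuous_intros continuous_log_growth\<close>)
  then show ?thesis unfolding Q_eq[abs_def]
    by (subst (asm) at_within_interior) (use s in \<open>auto simp: interior_atLeastAtMost_real\<close>)
qed

lemma Q_nonneg: "Q t \<ge> 0"
  by (auto simp: set_lebesgue_integral_def intro!: integral_nonneg_AE)

lemma path_nonneg: "x \<ge> 0 \<Longrightarrow> logistic_path q x t \<ge> 0"
  unfolding logistic_path_def using Q_nonneg[of t] by simp

lemma path_0 [simp]: "logistic_path q x 0 = x"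
proof -
  have "log_growth q 0 = 0" "Q 0 = 0"
    by (simp_all only: Q_eq) (simp_all add: log_growth_eq)
  then show ?thesis by (simp add: logistic_path_def)
qed

text \<open>Here the half-line enters: for a negative start the denominator could vanish, which
  means blow-up in finite time.\<close>

lemma Q_pos: "x \<ge> 0 \<Longrightarrow> 1 + x * Q t > 0"
  using Q_nonneg[of t] by (meson add_pos_nonneg mult_nonneg_nonneg zero_less_one)

lemma continuous_path: "x \<ge> 0 \<Longrightarrow> continuous_on {0..T} (logistic_path q x)"
  unfolding logistic_path_def[abs_def]
  by (intro continuous_intros continuous_log_growth continuous_Q) (metis Q_pos less_irrefl)

lemma deriv_path:
  assumes x: "x \<ge> 0" and s: "0 < s" and ev: "\<forall>\<^sub>F u in nhds s. q u = q s"
  shows "(logistic_path q x has_real_derivative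
     q s * logistic_path q x s - (logistic_path q x s)\<^sup>2) (at s)"
proof -
  note [derivative_intros] = deriv_log_growth[OF s ev] deriv_Q[OF s]
  define E D where "E = exp (log_growth q s)" and "D = 1 + x * Q s"
  have D: "D \<noteq> 0" using Q_pos[OF x, of s] by (simp add: D_def)
  have "(logistic_path q x has_real_derivative
      (x * (E * q s) * D - x * E * (x * E)) / (D * D)) (at s)"
    unfolding logistic_path_def[abs_def]
    by (rule derivative_eq_intros refl)+ (use D in \<open>simp_all add: D_def E_def\<close>)
  moreover have "(x * (E * q s) * D - x * E * (x * E)) / (D * D) = q s * (x * E / D) - (x * E / D)\<^sup>2"
    using D by (simp add: divide_simps power2_eq_square)
  ultimately show ?thesis
    by (simp add: logistic_path_def D_def E_def)
qed

lemma path_has_integral: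
  assumes x: "x \<ge> 0" and t: "t \<ge> 0"
  shows "((\<lambda>s. q s * logistic_path q x s - (logistic_path q x s)\<^sup>2)
    has_integral (logistic_path q x t - x)) {0..t}"
proof -
  obtain S where S: "finite S" "\<forall>s\<in>{0<..<t} - S. \<forall>\<^sub>F u in nhds s. q u = q s"
    using step by blast
  have "((\<lambda>s. q s * logistic_path q x s - (logistic_path q x s)\<^sup>2)
    has_integral (logistic_path q x t - logistic_path q x 0)) {0..t}"
    by (rule fundamental_theorem_of_calculus_interior_strong[OF S(1) t])
      (use S(2) x in \<open>auto intro!: continuous_path deriv_path
         simp: has_real_derivative_iff_has_vector_derivative[symmetric]\<close>)
  then show ?thesis by simp
qed

text \<open>The difference of two solutions solves the linear equation (Y - X)' = (q - X - Y)(Y -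
  X), so an integrating factor makes it constant. \<open>Y\<close> is an arbitrary function with the
  integral equation; neither a sign nor continuity is presupposed, since the choice operator
  guarantees nothing more.\<close>

lemma path_unique:
  assumes x: "x \<ge> 0" and T: "T \<ge> 0"
    and Y: "\<And>t. t \<ge> 0 \<Longrightarrow> ((\<lambda>s. q s * Y s - (Y s)\<^sup>2) has_integral (Y t - x)) {0..t}"
  shows "Y T = logistic_path q x T"
proof -
  let ?X = "logistic_path q x" and ?F = "\<lambda>s. q s * Y s - (Y s)\<^sup>2"
  obtain S where S: "finite S" "\<forall>s\<in>{0<..<T} - S. \<forall>\<^sub>F u in nhds s. q u = q s"
    using step by blast
  have Yi: "Y t = x + integral {0..t} ?F" "?F integrable_on {0..t}" if "t \<ge> 0" for t
    using Y[OF that] by (auto simp: has_integral_integrable integral_unique)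
  \<comment> \<open>The integral equation itself exhibits \<open>Y\<close> as an indefinite
    integral, hence as continuous, and then as differentiable wherever \<open>q\<close> is locally
    constant.\<close>
  have cY: "continuous_on {0..t} Y" for t
  proof (cases "t \<ge> 0")
    case True
    have "continuous_on {0..t} (\<lambda>t. x + integral {0..t} ?F)"
      by (intro continuous_intros indefinite_integral_continuous_1 Yi True)
    then show ?thesis
      by (rule continuous_on_eq) (use Yi in auto)
  qed auto
  have dY: "(Y has_real_derivative ?F s) (at s)"
    if s: "s > 0" "\<forall>\<^sub>F u in nhds s. q u = q s" for s
  proof -
    have iY: "isCont Y s"
      using continuous_on_interior[OF cY[of "s+1"]] s by (auto simp: interior_atLeastAtMost_real)
    have "isCont q s"
      unfolding isCont_def by (rule Lim_transform_eventually[OF tendsto_const[of "q s"]])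
        (use s in \<open>auto simp: eventually_at_filter elim!: eventually_mono\<close>)
    then have "isCont ?F s" by (intro continuous_intros iY)
    then have c: "continuous (at s within {0..s+1} - {}) ?F"
      by (rule continuous_at_imp_continuous_at_within)
    have "((\<lambda>u. integral {0..u} ?F) has_vector_derivative ?F s) (at s within {0..s+1} - {})"
      by (rule integral_has_vector_derivative_continuous_at[OF Yi(2) _ _ c]) (use s in auto)
    then have "((\<lambda>u. integral {0..u} ?F) has_real_derivative ?F s) (at s)"
      unfolding has_real_derivative_iff_has_vector_derivative
      by (subst (asm) at_within_interior) (use s in \<open>auto simp: interior_atLeastAtMost_real\<close>)
    then have "((\<lambda>u. x + integral {0..u} ?F) has_real_derivative ?F s) (at s)"
      using DERIV_add[OF DERIV_const[of x]] by fastforce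
    then show ?thesis
      by (rule has_field_derivative_transform_within_open[where S = "{0<..}"]) (use s Yi in auto)
  qed
  define G where "G = (\<lambda>t. integral {0..t} (\<lambda>s. ?X s + Y s))"
  have cXY: "continuous_on {0..t} (\<lambda>s. ?X s + Y s)" for t
    by (intro continuous_intros continuous_path x cY)
  have cG: "continuous_on {0..t} G" for t
    unfolding G_def by (intro indefinite_integral_continuous_1 integrable_continuous_interval cXY)
  have dG: "(G has_real_derivative (?X s + Y s)) (at s)" if "s > 0" for s
  proof -
    have "(G has_real_derivative (?X s + Y s)) (at s within {0..s+1})"
      unfolding G_def by (rule integral_has_real_derivative) (use that cXY in auto)
    then show ?thesis
      by (subst (asm) at_within_interior) (use that in \<open>auto simp: interior_atLeastAtMost_real\<close>)
  qed
  \<comment> \<open>\<open>G\<close> is an antiderivative of X + Y, so the exponential is the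
    inverse of the growth factor of Y - X.\<close>
  define Z where "Z = (\<lambda>t. (Y t - ?X t) * exp (G t - log_growth q t))"
  have "((\<lambda>s. 0) has_integral (Z T - Z 0)) {0..T}"
  proof (rule fundamental_theorem_of_calculus_interior_strong[OF S(1) T])
    show "continuous_on {0..T} Z" unfolding Z_def
      by (intro continuous_intros cY continuous_path x cG continuous_log_growth)
    fix s assume s: "s \<in> {0<..<T} - S"
    then have s0: "0 < s" and ev: "\<forall>\<^sub>F u in nhds s. q u = q s" using S(2) by auto
    note [derivative_intros] = dY[OF s0 ev] deriv_path[OF x s0 ev] dG[OF s0] deriv_log_growth[OF s0 ev]
    have "(Z has_real_derivative 0) (at s)" unfolding Z_def
      by (rule derivative_eq_intros refl)+ (simp add: algebra_simps power2_eq_square)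
    then show "(Z has_vector_derivative 0) (at s)"
      by (simp add: has_real_derivative_iff_has_vector_derivative)
  qed
  then have "Z T = Z 0" by simp
  moreover have "Z 0 = 0" using Yi(1)[of 0] by (simp add: Z_def)
  ultimately show ?thesis by (simp add: Z_def)
qed

end

section \<open>Measurable dependence of the solution on start and coefficient\<close>

lemma borel_measurable_log_growth:
  assumes [measurable]: "(\<lambda>(\<omega>, s). q \<omega> s) \<in> borel_measurable (M \<Otimes>\<^sub>M borel)"
  shows "(\<lambda>(\<omega>, t). log_growth (q \<omega>) t) \<in> borel_measurable (M \<Otimes>\<^sub>M borel)"
proof -
  have [measurable]: "(\<lambda>x. q (fst (fst x)) (snd x)) \<in> borel_measurable ((M \<Otimes>\<^sub>M borel) \<Otimes>\<^sub>M lborel)"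
    using measurable_compose[of "\<lambda>x. (fst (fst x), snd x)" "(M \<Otimes>\<^sub>M borel) \<Otimes>\<^sub>M lborel" "M \<Otimes>\<^sub>M borel", OF _ assms]
    by simp
  show ?thesis
    unfolding log_growth_def set_lebesgue_integral_def case_prod_beta
    by (rule lborel.borel_measurable_lebesgue_integral)
      (simp add: case_prod_beta indicator_def)
qed

text \<open>The explicit formula pays off: its ingredients are parametric integrals, whereas a bare
  existence statement would say nothing about the dependence on \<open>x\<close> and
  \<open>\<omega>\<close>.\<close>

lemma borel_measurable_logistic_path:
  assumes [measurable]: "(\<lambda>(\<omega>, s). q \<omega> s) \<in> borel_measurable (M \<Otimes>\<^sub>M borel)"
  shows "(\<lambda>(x, \<omega>). logistic_path (q \<omega>) x t) \<in> borel_measurable (borel \<Otimes>\<^sub>M M)"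
proof -
  note m = borel_measurable_log_growth[OF assms]
  have [measurable]: "(\<lambda>(\<omega>, t). log_growth (q \<omega>) t) \<in> borel_measurable (M \<Otimes>\<^sub>M lborel)"
    using m by simp
  have [measurable]: "(\<lambda>\<omega>. log_growth (q \<omega>) t) \<in> borel_measurable M"
    using measurable_compose[of "\<lambda>\<omega>. (\<omega>, t)" M "M \<Otimes>\<^sub>M borel", OF _ m] by simp
  have [measurable]: "(\<lambda>\<omega>. LINT s:{0..t}|lborel. exp (log_growth (q \<omega>) s)) \<in> borel_measurable M"
    unfolding set_lebesgue_integral_def
    by (rule lborel.borel_measurable_lebesgue_integral) (simp add: case_prod_beta indicator_def)
  show ?thesis unfolding logistic_path_def by measurable
qed

section \<open>The environment chain\<close>

text \<open>The laws of the holding times all live on this product Borel space, so measurability is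
  shown once, independently of the rates and the initial state.\<close>

abbreviation time_space :: "(nat \<Rightarrow> real) measure" where
  "time_space \<equiv> \<Pi>\<^sub>M n\<in>UNIV. borel"

lemma measurable_jump_time [measurable]: "(\<lambda>\<omega>. jump_time \<omega> n) \<in> borel_measurable time_space"
  unfolding jump_time_def by measurable

lemma measurable_regular_times [measurable]: "Measurable.pred time_space regular_times"
proof -
  \<comment> \<open>Divergence quantifies over all real levels; natural levels suffice and leave
    countably many conditions.\<close>
  have "filterlim (jump_time \<omega>) at_top sequentially \<longleftrightarrow>
      (\<forall>k::nat. \<exists>N. \<forall>n\<ge>N. real k \<le> jump_time \<omega> n)" for \<omega>
  proof
    assume "filterlim (jump_time \<omega>) at_top sequentially"
    then show "\<forall>k::nat. \<exists>N. \<forall>n\<ge>N. real k \<le> jump_time \<omega> n"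
      by (auto simp: filterlim_at_top eventually_sequentially)
  next
    assume *: "\<forall>k::nat. \<exists>N. \<forall>n\<ge>N. real k \<le> jump_time \<omega> n"
    show "filterlim (jump_time \<omega>) at_top sequentially"
      unfolding filterlim_at_top eventually_sequentially
    proof
      fix z :: real
      obtain k :: nat where "z \<le> real k" using real_arch_simple by blast
      with * show "\<exists>N. \<forall>n\<ge>N. z \<le> jump_time \<omega> n" by (meson order_trans)
    qed
  qed
  then have eq: "regular_times \<omega> \<longleftrightarrow> (\<forall>n. 0 < \<omega> n) \<and> (\<forall>k::nat. \<exists>N. \<forall>n\<ge>N. real k \<le> jump_time \<omega> n)" for \<omega>
    by (simp add: regular_times_def)
  have m: "Measurable.pred time_space (\<lambda>\<omega>. (\<forall>n. 0 < \<omega> n) \<and> (\<forall>k::nat. \<exists>N. \<forall>n\<ge>N. real k \<le> jump_time \<omega> n))"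
    by measurable
  show ?thesis
    by (rule measurable_cong[THEN iffD2, OF _ m]) (rule eq)
qed

lemma measurable_environment:
  "(\<lambda>(\<omega>, t). environment i \<omega> t) \<in> measurable (time_space \<Otimes>\<^sub>M borel) (count_space UNIV)"
  unfolding environment_def case_prod_beta by measurable

lemma environment_in_env_states:
  assumes "i \<in> env_states"
  shows "environment i \<omega> t \<in> env_states"
proof -
  have "(-1::int) ^ n = 1 \<or> (-1::int) ^ n = -1" for n
    by (cases "even n") auto
  then have "environment i \<omega> t = i \<or> environment i \<omega> t = - i"
    unfolding environment_def by (metis mult.right_neutral mult_minus_right)
  then show ?thesis
    using assms by (auto simp: env_states_def)
qed

lemma finite_jumps:
  assumes "regular_times \<omega>"
  shows "finite {n. jump_time \<omega> (Suc n) \<le> t}"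
proof -
  have "\<forall>\<^sub>F n in sequentially. t < jump_time \<omega> n"
    using assms by (simp add: regular_times_def filterlim_at_top_dense)
  then obtain N where "\<And>n. n \<ge> N \<Longrightarrow> t < jump_time \<omega> n"
    by (auto simp: eventually_sequentially)
  then have "{n. jump_time \<omega> (Suc n) \<le> t} \<subseteq> {..<N}"
    by (force simp: not_le[symmetric])
  then show ?thesis by (rule finite_subset) simp
qed

text \<open>The radius is bounded by the distance to the jump times up to \<open>T\<close>, and by
  \<open>T - s\<close> so that jumps after \<open>T\<close> cannot interfere.\<close>

lemma environment_locally_constant:
  assumes "regular_times \<omega>"
    and s: "s \<in> {0<..<T} - (\<lambda>n. jump_time \<omega> (Suc n)) ` {n. jump_time \<omega> (Suc n) \<le> T}"
  shows "\<forall>\<^sub>F u in nhds s. environment i \<omega> u = environment i \<omega> s"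
proof -
  let ?J = "(\<lambda>n. jump_time \<omega> (Suc n)) ` {n. jump_time \<omega> (Suc n) \<le> T}"
  have "finite ?J" using finite_jumps[OF assms(1)] by simp
  then obtain d where d: "d > 0" "\<And>y. y \<in> ?J \<Longrightarrow> y \<noteq> s \<Longrightarrow> d \<le> dist s y"
    using finite_set_avoid[of ?J s] by auto
  have "{n. jump_time \<omega> (Suc n) \<le> u} = {n. jump_time \<omega> (Suc n) \<le> s}"
    if "dist u s < min d (T - s)" for u
  proof -
    have "jump_time \<omega> (Suc n) \<le> u \<longleftrightarrow> jump_time \<omega> (Suc n) \<le> s" for n
    proof (cases "jump_time \<omega> (Suc n) \<le> T")
      case True
      then have "d \<le> \<bar>jump_time \<omega> (Suc n) - s\<bar>"
        using d(2)[of "jump_time \<omega> (Suc n)"] s True by (force simp: dist_real_def abs_minus_commute)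
      then show ?thesis using that by (auto simp: dist_real_def)
    next
      case False
      then show ?thesis using that s by (auto simp: dist_real_def)
    qed
    then show ?thesis by simp
  qed
  then have "\<forall>u. dist u s < min d (T - s) \<longrightarrow> environment i \<omega> u = environment i \<omega> s"
    by (simp add: environment_def)
  moreover have "min d (T - s) > 0" using d(1) s by simp
  ultimately show ?thesis unfolding eventually_nhds_metric by blast
qed

lemma environment_before_first_jump:
  assumes "regular_times \<omega>" "t < \<omega> 0"
  shows "environment i \<omega> t = i"
proof -
  have "\<omega> 0 \<le> jump_time \<omega> (Suc n)" for n
  proof -
    have "sum \<omega> {..<Suc 0} \<le> sum \<omega> {..<Suc n}"
      using assms(1) by (intro sum_mono2) (auto simp: regular_times_def less_imp_le)
    then show ?thesis by (simp add: jump_time_def)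
  qed
  then have "{n. jump_time \<omega> (Suc n) \<le> t} = {}"
    using assms(2) by (auto simp: not_le intro: less_le_trans)
  then show ?thesis by (simp add: environment_def del: Collect_empty_eq)
qed

text \<open>Exactly the index 0 is counted, because the index \<open>n\<close> stands for the jump
  at \<open>jump_time \<omega> (Suc n)\<close>.\<close>

lemma environment_after_first_jump:
  assumes "regular_times \<omega>" "\<omega> 0 \<le> t" "t < \<omega> 0 + \<omega> 1"
  shows "environment i \<omega> t = - i"
proof -
  have "\<omega> 0 + \<omega> 1 \<le> jump_time \<omega> (Suc (Suc n))" for n
  proof -
    have "sum \<omega> {..<2} \<le> sum \<omega> {..<Suc (Suc n)}"
      using assms(1) by (intro sum_mono2) (auto simp: regular_times_def less_imp_le)
    then show ?thesis by (simp add: jump_time_def numeral_2_eq_2)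
  qed
  then have "\<not> jump_time \<omega> (Suc (Suc n)) \<le> t" for n
    using assms(3) by (meson less_le_trans not_le)
  then have "jump_time \<omega> (Suc n) \<le> t \<longleftrightarrow> n = 0" for n
    using assms(2) by (cases n) (auto simp: jump_time_def)
  then have "{n. jump_time \<omega> (Suc n) \<le> t} = {0}" by auto
  then have "card {n. jump_time \<omega> (Suc n) \<le> t} = 1" by simp
  then show ?thesis using assms(1) by (simp add: environment_def)
qed

section \<open>Law of the holding times and almost sure regularity\<close>

lemma sets_holding_times [measurable_cong, simp]: "sets (holding_times r i) = sets time_space"
  unfolding holding_times_def by (intro sets_PiM_cong) auto

lemma space_holding_times [simp]: "space (holding_times r i) = UNIV"
  unfolding holding_times_def by (simp add: space_PiM)

text \<open>Positivity is asked at every integer, because the rates are read at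
  \<open>i * (-1) ^ n\<close> for an initial label \<open>i\<close> that ranges over all
  integers.\<close>

locale jump_rates =
  fixes r :: "int \<Rightarrow> real"
  assumes rate_pos: "\<And>i. r i > 0"
begin

sublocale hold: product_prob_space "\<lambda>n. density lborel (\<lambda>s. ennreal (exponential_density (r (i * (-1) ^ n)) s))" UNIV for i
  by (intro product_prob_spaceI prob_space_exponential_density rate_pos)

sublocale H: prob_space "holding_times r i" for i
  unfolding holding_times_def by unfold_locales

lemma emeasure_holding_times:
  assumes "finite J" "\<And>j. j \<in> J \<Longrightarrow> A j \<in> sets borel"
  shows "emeasure (holding_times r i) {\<omega>. \<forall>j\<in>J. \<omega> j \<in> A j} =
    (\<Prod>j\<in>J. emeasure (density lborel (\<lambda>s. ennreal (exponential_density (r (i * (-1) ^ j)) s))) (A j))"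
  using hold.emeasure_PiM_Collect[of J A i] assms
  by (simp add: holding_times_def space_PiM PiE_def extensional_def)

lemma prob_holding_times_le:
  assumes "finite J" "t \<ge> 0"
  shows "H.prob i {\<omega>. \<forall>j\<in>J. \<omega> j \<le> t} = (\<Prod>j\<in>J. 1 - exp (- (r (i * (-1) ^ j) * t)))"
proof -
  \<comment> \<open>The exponential density is the Erlang density with parameter 0, hence the Erlang
    distribution function.\<close>
  have "emeasure (holding_times r i) {\<omega>. \<forall>j\<in>J. \<omega> j \<in> {..t}} =
      (\<Prod>j\<in>J. ennreal (1 - exp (- (r (i * (-1) ^ j) * t))))"
    by (subst emeasure_holding_times)
      (use assms in \<open>auto intro!: prod.cong simp: emeasure_erlang_density rate_pos erlang_CDF_def\<close>)
  also have "\<dots> = ennreal (\<Prod>j\<in>J. 1 - exp (- (r (i * (-1) ^ j) * t)))"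
    by (rule prod_ennreal) (use assms rate_pos in \<open>simp add: less_imp_le\<close>)
  finally show ?thesis
    by (simp add: measure_def prod_nonneg assms rate_pos less_imp_le)
qed

lemma sets_holding_times_le:
  assumes "countable J" shows "{\<omega>. \<forall>j\<in>J. \<omega> j \<le> t} \<in> sets (holding_times r i)"
proof -
  have "{\<omega> \<in> space time_space. \<forall>j\<in>J. \<omega> j \<le> t} \<in> sets time_space"
    using assms by measurable
  then show ?thesis by (simp add: space_PiM)
qed

lemma AE_holding_times_pos: "AE \<omega> in holding_times r i. 0 < \<omega> n"
proof (rule AE_I)
  show "{\<omega> \<in> space (holding_times r i). \<not> 0 < \<omega> n} \<subseteq> {\<omega>. \<forall>j\<in>{n}. \<omega> j \<le> 0}" by auto
  show "emeasure (holding_times r i) {\<omega>. \<forall>j\<in>{n}. \<omega> j \<le> 0} = 0"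
    unfolding H.emeasure_eq_measure by (subst prob_holding_times_le) auto
  show "{\<omega>. \<forall>j\<in>{n}. \<omega> j \<le> 0} \<in> sets (holding_times r i)"
    by (rule sets_holding_times_le) simp
qed

text \<open>By independence the first \<open>n\<close> times all stay below \<open>c\<close> with
  probability at most \<open>\<theta> ^ n\<close>, for every \<open>n\<close>; the larger of the two
  rates gives the worst factor \<open>\<theta>\<close>, still below 1.\<close>

lemma AE_holding_times_unbounded:
  assumes i: "i \<in> env_states" and c: "c \<ge> 0"
  shows "AE \<omega> in holding_times r i. \<not> (\<forall>n. \<omega> n \<le> c)"
proof (rule AE_I)
  let ?N = "{\<omega>. \<forall>j\<in>UNIV. \<omega> j \<le> c}"
  define \<theta> where "\<theta> = 1 - exp (- (max (r 1) (r (-1)) * c))"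
  have \<theta>: "0 \<le> \<theta>" "\<theta> < 1"
    using c rate_pos[of 1] by (auto simp: \<theta>_def intro!: mult_nonneg_nonneg)
  have "H.prob i ?N \<le> \<theta> ^ n" for n
  proof -
    have "H.prob i ?N \<le> H.prob i {\<omega>. \<forall>j\<in>{..<n}. \<omega> j \<le> c}"
      by (intro H.finite_measure_mono sets_holding_times_le) auto
    also have "\<dots> = (\<Prod>j<n. 1 - exp (- (r (i * (-1) ^ j) * c)))"
      by (rule prob_holding_times_le) (use c in auto)
    also have "\<dots> \<le> (\<Prod>j<n. \<theta>)"
    proof (rule prod_mono, safe)
      fix j
      have "(-1::int) ^ j = 1 \<or> (-1::int) ^ j = -1" by (cases "even j") auto
      then have "r (i * (-1) ^ j) \<le> max (r 1) (r (-1))"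
        using i by (auto simp: env_states_def)
      then show "1 - exp (- (r (i * (-1) ^ j) * c)) \<le> \<theta>"
        using c by (auto simp: \<theta>_def intro!: mult_right_mono)
      show "0 \<le> 1 - exp (- (r (i * (-1) ^ j) * c))"
        using c rate_pos[of "i * (-1) ^ j"] by simp
    qed
    finally show ?thesis by simp
  qed
  then have "H.prob i ?N \<le> 0"
    using LIMSEQ_le_const[OF LIMSEQ_power_zero[of \<theta>]] \<theta> by auto
  then have "H.prob i ?N = 0" using measure_nonneg[of "holding_times r i" ?N] by linarith
  then show "emeasure (holding_times r i) ?N = 0" by (simp add: H.emeasure_eq_measure)
  show "?N \<in> sets (holding_times r i)" by (rule sets_holding_times_le) simp
qed auto

text \<open>Jump times increase, so to diverge they only have to exceed each level once, and a
  single holding time longer than the level achieves that. Unboundedness of the sequence thus takes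
  the place of a Borel-Cantelli argument.\<close>

lemma AE_regular_times:
  assumes "i \<in> env_states"
  shows "AE \<omega> in holding_times r i. regular_times \<omega>"
proof -
  have "AE \<omega> in holding_times r i. \<forall>n. 0 < \<omega> n"
    by (simp add: AE_all_countable AE_holding_times_pos)
  moreover have "AE \<omega> in holding_times r i. \<forall>c::nat. \<not> (\<forall>n. \<omega> n \<le> real c)"
    using assms by (simp add: AE_all_countable AE_holding_times_unbounded del: not_all)
  ultimately show ?thesis
  proof eventually_elim
    case (elim \<omega>)
    have mono: "jump_time \<omega> m \<le> jump_time \<omega> n" if "m \<le> n" for m n
      unfolding jump_time_def using elim(1) that by (intro sum_mono2) (auto simp: less_imp_le)
    have "filterlim (jump_time \<omega>) at_top sequentially"
      unfolding filterlim_at_top eventually_sequentially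
    proof
      fix z :: real
      obtain c :: nat where c: "z \<le> real c" using real_arch_simple by blast
      obtain n where n: "real c < \<omega> n" using elim(2) by (meson not_le)
      have "0 \<le> jump_time \<omega> n"
        unfolding jump_time_def using elim(1) by (intro sum_nonneg) (auto simp: less_imp_le)
      then have "z \<le> jump_time \<omega> (Suc n)" using c n by (simp add: jump_time_def)
      then show "\<exists>N. \<forall>n\<ge>N. z \<le> jump_time \<omega> n" using mono order_trans by blast
    qed
    then show ?case using elim(1) by (simp add: regular_times_def)
  qed
qed

end

section \<open>The transition kernel\<close>

locale logistic_switching =
  fixes p\<^sub>m p\<^sub>p l\<^sub>m l\<^sub>p :: real
  assumes p: "p\<^sub>m < 0" "0 < p\<^sub>p" and l: "0 < l\<^sub>m" "0 < l\<^sub>p"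
begin

abbreviation "f \<equiv> logistic_field p\<^sub>m p\<^sub>p"
abbreviation "r \<equiv> switch_rate l\<^sub>m l\<^sub>p"

sublocale jump_rates r
  by unfold_locales (use l in \<open>auto simp: switch_rate_def\<close>)

definition rate_path :: "int \<Rightarrow> (nat \<Rightarrow> real) \<Rightarrow> real \<Rightarrow> real" where
  "rate_path i \<omega> s = (if environment i \<omega> s = 1 then p\<^sub>p else p\<^sub>m)"

text \<open>Explicit stand-in for \<open>switched_path\<close>, defined for every
  \<open>\<omega>\<close>, including the irregular ones, where the environment is frozen.\<close>

definition position :: "int \<Rightarrow> (nat \<Rightarrow> real) \<Rightarrow> real \<Rightarrow> real \<Rightarrow> real" where
  "position i \<omega> x t = logistic_path (rate_path i \<omega>) x t"

lemma field_eq: "f (environment i \<omega> s) y = rate_path i \<omega> s * y - y\<^sup>2"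
  by (simp add: logistic_field_def rate_path_def)

lemma measurable_rate_path: "(\<lambda>(\<omega>, s). rate_path i \<omega> s) \<in> borel_measurable (time_space \<Otimes>\<^sub>M borel)"
proof -
  have "(\<lambda>(\<omega>, s). environment i \<omega> s) \<in> measurable (time_space \<Otimes>\<^sub>M borel) (count_space UNIV)"
    by (rule measurable_environment)
  then show ?thesis unfolding rate_path_def by measurable
qed

lemma step_rate_path: "step_rate (rate_path i \<omega>) (max \<bar>p\<^sub>m\<bar> \<bar>p\<^sub>p\<bar>)"
proof
  show "rate_path i \<omega> \<in> borel_measurable borel"
    using measurable_compose[of "\<lambda>s. (\<omega>, s)" borel "time_space \<Otimes>\<^sub>M borel", OF _ measurable_rate_path]
    by (simp add: space_PiM)
  show "\<bar>rate_path i \<omega> s\<bar> \<le> max \<bar>p\<^sub>m\<bar> \<bar>p\<^sub>p\<bar>" for s by (auto simp: rate_path_def)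
  show "\<exists>S. finite S \<and> (\<forall>s\<in>{0<..<T} - S. \<forall>\<^sub>F u in nhds s. rate_path i \<omega> u = rate_path i \<omega> s)" for T
  proof (cases "regular_times \<omega>")
    case True
    let ?J = "(\<lambda>n. jump_time \<omega> (Suc n)) ` {n. jump_time \<omega> (Suc n) \<le> T}"
    have "\<forall>\<^sub>F u in nhds s. rate_path i \<omega> u = rate_path i \<omega> s" if "s \<in> {0<..<T} - ?J" for s
      using environment_locally_constant[OF True that, of i]
      by eventually_elim (simp add: rate_path_def)
    then show ?thesis
      using finite_jumps[OF True, of T] by (intro exI[of _ ?J]) simp
  next
    case False
    then show ?thesis by (intro exI[of _ "{}"]) (simp add: rate_path_def environment_def)
  qed
qed

sublocale S: step_rate "rate_path i \<omega>" "max \<bar>p\<^sub>m\<bar> \<bar>p\<^sub>p\<bar>" for i \<omega>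
  by (rule step_rate_path)

text \<open>The closed form satisfies the defining property, so the choice operator returns some
  solution, and uniqueness identifies it. The equality holds for every \<open>\<omega>\<close> and
  not just almost surely, so the map inside \<open>distr\<close> inherits the measurability of the
  closed form.\<close>

lemma switched_path_eq:
  assumes "x \<ge> 0" "t \<ge> 0"
  shows "switched_path f x (environment i \<omega>) t = position i \<omega> x t"
proof -
  let ?P = "\<lambda>X. \<forall>t\<ge>0. ((\<lambda>s. f (environment i \<omega> s) (X s)) has_integral (X t - x)) {0..t}"
  have "?P (position i \<omega> x)"
    using S.path_has_integral[OF assms(1)] by (simp add: field_eq position_def)
  then have "?P (switched_path f x (environment i \<omega>))"
    unfolding switched_path_def by (rule someI[of ?P])
  then show ?thesis
    unfolding position_def using assms by (intro S.path_unique) (auto simp: field_eq)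
qed

lemma position_nonneg: "x \<ge> 0 \<Longrightarrow> position i \<omega> x t \<ge> 0"
  unfolding position_def by (rule S.path_nonneg)

lemma measurable_position: "(\<lambda>(x, \<omega>). position i \<omega> x t) \<in> borel_measurable (borel \<Otimes>\<^sub>M time_space)"
  unfolding position_def by (rule borel_measurable_logistic_path[OF measurable_rate_path])

text \<open>Landing in the restricted space takes more than Borel measurability: paths must stay
  nonnegative and the environment must stay in \<open>env_states\<close>. The start remains a
  variable, for the sake of measurability of the kernel in it.\<close>

lemma measurable_process:
  assumes i: "i \<in> env_states"
  shows "(\<lambda>(x, \<omega>). (position i \<omega> x t, environment i \<omega> t))
    \<in> measurable (restrict_space borel {0..} \<Otimes>\<^sub>M time_space) state_space"
proof -
  let ?M = "restrict_space borel {0..} \<Otimes>\<^sub>M time_space :: (real \<times> (nat \<Rightarrow> real)) measure"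
  have id: "(\<lambda>x. x) \<in> measurable ?M (borel \<Otimes>\<^sub>M time_space)"
  proof -
    have "fst \<in> measurable ?M borel"
      by (rule measurable_compose[OF measurable_fst measurable_restrict_space1]) simp
    then have "(\<lambda>x. (fst x, snd x)) \<in> measurable ?M (borel \<Otimes>\<^sub>M time_space)"
      by (intro measurable_Pair) simp_all
    then show ?thesis by simp
  qed
  have "(\<lambda>z. case z of (x, \<omega>) \<Rightarrow> position i \<omega> x t) \<in> borel_measurable ?M"
    by (rule measurable_compose[OF id measurable_position])
  then have 1: "(\<lambda>z. position i (snd z) (fst z) t) \<in> measurable ?M (restrict_space borel {0..})"
    by (intro measurable_restrict_space2)
      (auto simp: space_pair_measure space_restrict_space case_prod_beta position_nonneg)
  have "(\<lambda>\<omega>. environment i \<omega> t) \<in> measurable time_space (count_space UNIV)"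
    using measurable_compose[of "\<lambda>\<omega>. (\<omega>, t)" time_space "time_space \<Otimes>\<^sub>M borel", OF _ measurable_environment]
    by simp
  then have "(\<lambda>z. environment i (snd z) t) \<in> measurable ?M (count_space UNIV)"
    by (rule measurable_compose[OF measurable_snd])
  then have "(\<lambda>z. environment i (snd z) t) \<in> measurable ?M (restrict_space (count_space UNIV) env_states)"
    by (intro measurable_restrict_space2) (auto simp: environment_in_env_states i)
  then have 2: "(\<lambda>z. environment i (snd z) t) \<in> measurable ?M (count_space env_states)"
    by (simp add: restrict_count_space)
  show ?thesis unfolding state_space_def case_prod_beta
    by (rule measurable_Pair[OF 1 2])
qed

lemma measurable_process_fixed:
  assumes "i \<in> env_states" "x \<ge> 0"
  shows "(\<lambda>\<omega>. (position i \<omega> x t, environment i \<omega> t)) \<in> measurable (holding_times r i) state_space"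
proof -
  have "(\<lambda>\<omega>. (x, \<omega>)) \<in> measurable time_space (restrict_space borel {0..} \<Otimes>\<^sub>M time_space)"
    using assms by (intro measurable_Pair measurable_const) (auto simp: space_restrict_space)
  from measurable_compose[OF this measurable_process[OF assms(1)]] show ?thesis
    by (simp cong: measurable_cong_sets)
qed

lemma space_state_space: "space state_space = {0..} \<times> env_states"
  by (simp add: state_space_def space_pair_measure space_restrict_space)

lemma kernel_eq:
  assumes "i \<in> env_states" "x \<ge> 0" "t \<ge> 0"
  shows "pdmp_kernel f r t (x, i) =
    distr (holding_times r i) state_space (\<lambda>\<omega>. (position i \<omega> x t, environment i \<omega> t))"
  using assms by (simp add: pdmp_kernel_def switched_path_eq)

text \<open>Needed to phrase invariance as a fixed point under \<open>bind\<close>. For each state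
  the probability of \<open>A\<close> is a parametric integral over the holding times; the two
  states are glued by a countable case distinction.\<close>

lemma measurable_kernel:
  assumes t: "t \<ge> 0"
  shows "pdmp_kernel f r t \<in> measurable state_space (subprob_algebra state_space)"
proof (rule measurable_subprob_algebra)
  fix z assume "z \<in> space state_space"
  then have z: "snd z \<in> env_states" "fst z \<ge> 0" by (auto simp: space_state_space)
  interpret K: prob_space "pdmp_kernel f r t z"
    using kernel_eq[OF z t] H.prob_space_distr[OF measurable_process_fixed[OF z]] by simp
  show "subprob_space (pdmp_kernel f r t z)" by unfold_locales
  show "sets (pdmp_kernel f r t z) = sets state_space" by (simp add: pdmp_kernel_def)
next
  fix A assume A [measurable]: "A \<in> sets state_space"
  have "(\<lambda>x. emeasure (pdmp_kernel f r t (x, i)) A) \<in> borel_measurable (restrict_space borel {0..})"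
    if i: "i \<in> env_states" for i
  proof -
    have "(\<lambda>(x, \<omega>). indicator A (position i \<omega> x t, environment i \<omega> t) :: ennreal)
        \<in> borel_measurable (restrict_space borel {0..} \<Otimes>\<^sub>M holding_times r i)"
      using measurable_compose[OF measurable_process[OF i], of "indicator A" borel t]
      by (simp add: case_prod_beta' cong: measurable_cong_sets sets_pair_measure_cong)
    then have "(\<lambda>x. \<integral>\<^sup>+\<omega>. indicator A (position i \<omega> x t, environment i \<omega> t) \<partial>holding_times r i)
        \<in> borel_measurable (restrict_space borel {0..})"
      by (rule H.borel_measurable_nn_integral)
    then show ?thesis
    proof (rule measurable_cong[THEN iffD1, rotated])
      fix x :: real assume "x \<in> space (restrict_space borel {0..})"
      then have x: "x \<ge> 0" by (simp add: space_restrict_space)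
      show "(\<integral>\<^sup>+\<omega>. indicator A (position i \<omega> x t, environment i \<omega> t) \<partial>holding_times r i)
          = emeasure (pdmp_kernel f r t (x, i)) A"
        unfolding kernel_eq[OF i x t]
        by (subst nn_integral_indicator[symmetric], simp add: A,
            subst nn_integral_distr[OF measurable_process_fixed[OF i x]]) (use A in simp_all)
    qed
  qed
  then have "(\<lambda>z. emeasure (pdmp_kernel f r t (fst z, snd z)) A) \<in> borel_measurable state_space"
    unfolding state_space_def
    by (intro measurable_compose_countable'[where g = snd and I = env_states
          and f = "\<lambda>i z. emeasure (pdmp_kernel f r t (fst z, i)) A"])
      (auto simp: env_states_def intro: measurable_compose[OF measurable_fst])
  then show "(\<lambda>z. emeasure (pdmp_kernel f r t z) A) \<in> borel_measurable state_space" by simp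
qed

end

section \<open>The generator\<close>

lemma measurable_state_space:
  assumes "\<And>i. i \<in> env_states \<Longrightarrow> h i \<in> borel_measurable borel"
  shows "(\<lambda>z. h (snd z) (fst z)) \<in> borel_measurable state_space"
  unfolding state_space_def
  by (rule measurable_compose_countable'[where g = snd and I = env_states and f = "\<lambda>i z. h i (fst z)"])
    (auto simp: env_states_def intro!: measurable_compose[OF measurable_fst] measurable_restrict_space1 assms)

context logistic_switching
begin

text \<open>The bound pairs each field with each component: before a jump the path follows one
  field, while the value after the jump is taken with the other component. It is imposed on the
  half-line, where the paths live.\<close>

definition test_function :: "(int \<Rightarrow> real \<Rightarrow> real) \<Rightarrow> (int \<Rightarrow> real \<Rightarrow> real) \<Rightarrow> bool" where
  "test_function g g' \<longleftrightarrow>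
     (\<forall>j x. (g j has_real_derivative g' j x) (at x)) \<and> (\<forall>j. continuous_on UNIV (g' j)) \<and>
     (\<exists>G. \<forall>j x. \<bar>g j x\<bar> \<le> G) \<and> (\<exists>C. \<forall>i j. \<forall>x\<ge>0. \<bar>f i x * g' j x\<bar> \<le> C)"

definition flow :: "int \<Rightarrow> real \<Rightarrow> real \<Rightarrow> real" where
  "flow i x t = position i (\<lambda>_. 0) x t" \<comment> \<open>vanishing holding times freeze the environment\<close>

lemma environment_frozen [simp]: "environment i (\<lambda>_. 0) s = i"
  by (simp add: environment_def regular_times_def)

lemma test_path_integral:
  assumes g: "\<And>x. (g has_real_derivative g' x) (at x)" and x: "x \<ge> 0" and t: "t \<ge> 0"
  shows "((\<lambda>s. f (environment i \<omega> s) (position i \<omega> x s) * g' (position i \<omega> x s))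
    has_integral (g (position i \<omega> x t) - g x)) {0..t}"
proof -
  obtain S where S: "finite S" "\<forall>s\<in>{0<..<t} - S. \<forall>\<^sub>F u in nhds s. rate_path i \<omega> u = rate_path i \<omega> s"
    using S.step by blast
  let ?h = "\<lambda>s. f (environment i \<omega> s) (position i \<omega> x s) * g' (position i \<omega> x s)"
  have "(?h has_integral (g (position i \<omega> x t) - g (position i \<omega> x 0))) {0..t}"
  proof (rule fundamental_theorem_of_calculus_interior_strong[OF S(1) t])
    have "continuous_on UNIV g"
      by (rule continuous_at_imp_continuous_on) (use g DERIV_isCont in blast)
    then show "continuous_on {0..t} (\<lambda>s. g (position i \<omega> x s))"
      unfolding position_def using S.continuous_path[OF x]
      by (rule continuous_on_compose2) auto
    fix s assume s: "s \<in> {0<..<t} - S"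
    have "(position i \<omega> x has_real_derivative f (environment i \<omega> s) (position i \<omega> x s)) (at s)"
      unfolding field_eq position_def[abs_def] by (rule S.deriv_path[OF x]) (use S(2) s in auto)
    from DERIV_chain2[OF g this]
    show "((\<lambda>s. g (position i \<omega> x s)) has_vector_derivative ?h s) (at s)"
      by (simp add: has_real_derivative_iff_has_vector_derivative mult.commute)
  qed
  then show ?thesis by (simp add: position_def)
qed

lemma test_path_bound:
  assumes g: "\<And>x. (g has_real_derivative g' x) (at x)"
    and C: "\<And>i x. x \<ge> 0 \<Longrightarrow> \<bar>f i x * g' x\<bar> \<le> C"
    and x: "x \<ge> 0" and t: "t \<ge> 0"
  shows "\<bar>g (position i \<omega> x t) - g x\<bar> \<le> C * t"
proof -
  let ?h = "\<lambda>s. f (environment i \<omega> s) (position i \<omega> x s) * g' (position i \<omega> x s)"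
  have "0 \<le> C" using C[of 0] by (meson abs_ge_zero order_refl order_trans)
  moreover have "norm (?h s) \<le> C" for s
    using C[OF position_nonneg[OF x]] by simp
  ultimately have "norm (g (position i \<omega> x t) - g x) \<le> C * measure lborel {0..t}"
    using test_path_integral[OF g x t] by (intro has_integral_bound_real[where f = ?h]) auto
  then show ?thesis using t by simp
qed

text \<open>A one-sided derivative at time 0, within \<open>{0..1}\<close>, because the path solves
  the equation for nonnegative times. Continuity of \<open>g'\<close> makes the integrand continuous
  along the flow.\<close>

lemma test_flow_deriv:
  assumes g: "\<And>x. (g has_real_derivative g' x) (at x)" and c: "continuous_on UNIV g'" and x: "x \<ge> 0"
  shows "((\<lambda>t. g (flow i x t)) has_real_derivative f i x * g' x) (at 0 within {0..1})"
proof -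
  let ?h = "\<lambda>s. f i (flow i x s) * g' (flow i x s)"
  have "continuous_on {0..1} (flow i x)"
    unfolding flow_def[abs_def] position_def by (rule S.continuous_path[OF x])
  then have "continuous_on {0..1} ?h"
    unfolding logistic_field_def
    by (intro continuous_intros continuous_on_compose2[OF c]) auto
  then have "((\<lambda>t. integral {0..t} ?h) has_real_derivative ?h 0) (at 0 within {0..1})"
    by (rule integral_has_real_derivative) simp
  then have "((\<lambda>t. g x + integral {0..t} ?h) has_real_derivative ?h 0) (at 0 within {0..1})"
    using DERIV_add[OF DERIV_const[of "g x"]] by fastforce
  then have "((\<lambda>t. g (flow i x t)) has_real_derivative ?h 0) (at 0 within {0..1})"
  proof (rule has_field_derivative_transform_within[OF _ zero_less_one])
    fix t :: real assume "t \<in> {0..1}"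
    then show "g x + integral {0..t} ?h = g (flow i x t)"
      using integral_unique[OF test_path_integral[OF g x, of t i "\<lambda>_. 0"]] by (auto simp: flow_def)
  qed auto
  then show ?thesis by (simp add: flow_def position_def)
qed

lemma position_before_first_jump:
  assumes "regular_times \<omega>" "t < \<omega> 0" "x \<ge> 0" "t \<ge> 0"
  shows "position i \<omega> x t = flow i x t"
proof -
  have q: "rate_path i \<omega> s = rate_path i (\<lambda>_. 0) s" if "s \<in> {0..t}" for s
    using that assms by (simp add: rate_path_def environment_before_first_jump)
  have e: "log_growth (rate_path i \<omega>) s = log_growth (rate_path i (\<lambda>_. 0)) s" if "s \<in> {0..t}" for s
    unfolding log_growth_def set_lebesgue_integral_def
    by (rule Bochner_Integration.integral_cong) (use that q in \<open>auto simp: indicator_def\<close>)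
  have "(LINT s:{0..t}|lborel. exp (log_growth (rate_path i \<omega>) s)) =
      (LINT s:{0..t}|lborel. exp (log_growth (rate_path i (\<lambda>_. 0)) s))"
    unfolding set_lebesgue_integral_def
    by (rule Bochner_Integration.integral_cong) (use e in \<open>auto simp: indicator_def\<close>)
  then show ?thesis
    using e[of t] assms by (simp add: position_def flow_def logistic_path_def)
qed

lemma kernel_expansion:
  assumes i: "i \<in> env_states" and x: "x \<ge> 0" and t: "t \<ge> 0"
    and g: "\<And>j x. (g j has_real_derivative g' j x) (at x)"
    and G: "\<And>j x. \<bar>g j x\<bar> \<le> G"
    and C: "\<And>i j x. x \<ge> 0 \<Longrightarrow> \<bar>f i x * g' j x\<bar> \<le> C"
  shows "\<bar>(\<integral>y. g (snd y) (fst y) \<partial>pdmp_kernel f r t (x, i))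
      - (g i (flow i x t) + (1 - exp (- (r i * t))) * (g (- i) x - g i (flow i x t)))\<bar>
    \<le> (C * r i + 2 * G * r i * r (- i)) * t\<^sup>2"
proof -
  let ?H = "holding_times r i"
  let ?F = "\<lambda>\<omega>. g (environment i \<omega> t) (position i \<omega> x t)"
  \<comment> \<open>\<open>N\<close> is the event of a jump by time \<open>t\<close>.
    \<open>D\<close> contains the event of two jumps; it is taken larger than that event so that
    independence gives its probability as a product.\<close>
  define N where "N = {\<omega>::nat\<Rightarrow>real. \<forall>j\<in>{0::nat}. \<omega> j \<le> t}"
  define D where "D = {\<omega>::nat\<Rightarrow>real. \<forall>j\<in>{0::nat,1}. \<omega> j \<le> t}"
  \<comment> \<open>Comparison variable: the exact value without a jump, and otherwise the other
    component at the unmoved starting point.\<close>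
  define a where "a = (\<lambda>\<omega>. g i (flow i x t) + indicator N \<omega> * (g (- i) x - g i (flow i x t)))"
  have G0: "0 \<le> G" using G[of 0 0] by (meson abs_ge_zero order_trans)
  have C0: "0 \<le> C" using C[of 0] by (meson abs_ge_zero order_refl order_trans)
  have ND [measurable]: "N \<in> sets ?H" "D \<in> sets ?H"
    unfolding N_def D_def by (rule sets_holding_times_le, simp)+
  have PN: "H.prob i N = 1 - exp (- (r i * t))"
    unfolding N_def by (subst prob_holding_times_le) (use t in auto)
  have PD: "H.prob i D = (1 - exp (- (r i * t))) * (1 - exp (- (r (- i) * t)))"
    unfolding D_def by (subst prob_holding_times_le) (use t in auto)
  have gm: "(\<lambda>y. g (snd y) (fst y)) \<in> borel_measurable state_space"
  proof (rule measurable_state_space)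
    fix j show "g j \<in> borel_measurable borel"
      by (intro borel_measurable_continuous_onI continuous_at_imp_continuous_on)
        (use g DERIV_isCont in blast)
  qed
  note mp = measurable_process_fixed[OF i x, of t]
  have Fm: "?F \<in> borel_measurable ?H"
    using measurable_compose[OF mp gm] by simp
  have iND: "integrable ?H (indicat_real N)" "integrable ?H (indicat_real D)"
    by (rule integrable_real_indicator[OF ND(1)] integrable_real_indicator[OF ND(2)],
        simp add: H.emeasure_eq_measure)+
  have Fi: "integrable ?H ?F"
    by (rule H.integrable_const_bound[of _ G]) (use G Fm in auto)
  have ai: "integrable ?H a"
    unfolding a_def using iND by simp
  have "(\<integral>y. g (snd y) (fst y) \<partial>pdmp_kernel f r t (x, i)) = (\<integral>\<omega>. ?F \<omega> \<partial>?H)"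
    unfolding kernel_eq[OF i x t] by (subst integral_distr[OF mp gm]) simp
  moreover have "(\<integral>\<omega>. a \<omega> \<partial>?H) = g i (flow i x t) + (1 - exp (- (r i * t))) * (g (- i) x - g i (flow i x t))"
    unfolding a_def using H.prob_space[of i]
    by (subst Bochner_Integration.integral_add) (use iND in \<open>auto simp: PN\<close>)
  moreover have "\<bar>(\<integral>\<omega>. ?F \<omega> \<partial>?H) - (\<integral>\<omega>. a \<omega> \<partial>?H)\<bar> \<le> (\<integral>\<omega>. C * t * indicator N \<omega> + 2 * G * indicator D \<omega> \<partial>?H)"
  proof -
    have "\<bar>\<integral>\<omega>. ?F \<omega> - a \<omega> \<partial>?H\<bar> \<le> (\<integral>\<omega>. C * t * indicator N \<omega> + 2 * G * indicator D \<omega> \<partial>?H)"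
    proof (rule order_trans[OF integral_abs_bound integral_mono_AE])
      show "integrable ?H (\<lambda>\<omega>. \<bar>?F \<omega> - a \<omega>\<bar>)"
        by (intro integrable_abs Bochner_Integration.integrable_diff Fi ai)
      show "integrable ?H (\<lambda>\<omega>. C * t * indicator N \<omega> + 2 * G * indicator D \<omega>)"
        using iND by simp
      show "AE \<omega> in ?H. \<bar>?F \<omega> - a \<omega>\<bar> \<le> C * t * indicator N \<omega> + 2 * G * indicator D \<omega>"
        using AE_regular_times[OF i]
      proof eventually_elim
        case (elim \<omega>)
        then have pos: "0 < \<omega> 0" by (simp add: regular_times_def)
        consider "t < \<omega> 0" | "\<omega> 0 \<le> t" "t < \<omega> 1" | "\<omega> 0 \<le> t" "\<omega> 1 \<le> t" by linarith
        then show ?case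
        proof cases
          case 1
          then show ?thesis
            using elim x t environment_before_first_jump[OF elim 1] position_before_first_jump[OF elim 1]
            by (simp add: a_def N_def D_def)
        next
          case 2
          then have "environment i \<omega> t = - i"
            using environment_after_first_jump[OF elim] pos by simp
          then show ?thesis
            using 2 test_path_bound[of "g (- i)" "g' (- i)" C x t i \<omega>] g C x t
            by (simp add: a_def N_def D_def)
        next
          case 3
          have "\<bar>?F \<omega> - g (- i) x\<bar> \<le> 2 * G"
            using G[of "environment i \<omega> t" "position i \<omega> x t"] G[of "- i" x] by linarith
          then show ?thesis using 3 C0 t
            by (simp add: a_def N_def D_def add_increasing)
        qed
      qed
    qed
    then show ?thesis using Fi ai by simp
  qed
  moreover have "(\<integral>\<omega>. C * t * indicator N \<omega> + 2 * G * indicator D \<omega> \<partial>?H) = C * t * H.prob i N + 2 * G * H.prob i D"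
    by (subst Bochner_Integration.integral_add) (use iND in auto)
  moreover have "C * t * H.prob i N \<le> C * t * (r i * t)"
    unfolding PN using exp_ge_add_one_self[of "- (r i * t)"] C0 t by (intro mult_left_mono) auto
  moreover have "2 * G * H.prob i D \<le> 2 * G * ((r i * t) * (r (- i) * t))"
    unfolding PD using exp_ge_add_one_self[of "- (r i * t)"] exp_ge_add_one_self[of "- (r (- i) * t)"]
      G0 t rate_pos[of i] rate_pos[of "- i"]
    by (intro mult_left_mono mult_mono) (auto simp: less_imp_le)
  ultimately show ?thesis by (simp add: power2_eq_square algebra_simps)
qed

section \<open>The infinitesimal form of invariance\<close>

definition generator :: "(int \<Rightarrow> real \<Rightarrow> real) \<Rightarrow> (int \<Rightarrow> real \<Rightarrow> real) \<Rightarrow> int \<Rightarrow> real \<Rightarrow> real" where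
  "generator g g' i x = f i x * g' i x + r i * (g (- i) x - g i x)"

lemma exp_quotient_tendsto: "((\<lambda>t. (1 - exp (- (c * t))) / t) \<longlongrightarrow> (c::real)) (at 0 within {0..1})"
proof -
  have "((\<lambda>t. 1 - exp (- (c * t))) has_real_derivative c) (at 0 within {0..1})"
    by (auto intro!: derivative_eq_intros)
  then show ?thesis by (simp add: has_field_derivative_iff)
qed

text \<open>By invariance \<open>g\<close> and its image under the kernel have the same mean, so the
  first-order model differs from \<open>g\<close> in mean by O(t^2). After division by the time the
  mean tends to 0, while dominated convergence identifies the limit as the mean of the
  generator.\<close>

lemma generator_mean_zero:
  assumes inv: "invariant_prob f r \<mu>" and test: "test_function g g'"
  shows "(\<integral>z. generator g g' (snd z) (fst z) \<partial>\<mu>) = 0"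
proof -
  have g: "\<And>j x. (g j has_real_derivative g' j x) (at x)" and g': "\<And>j. continuous_on UNIV (g' j)"
    using test by (auto simp: test_function_def)
  obtain G where G: "\<And>j x. \<bar>g j x\<bar> \<le> G" using test by (auto simp: test_function_def)
  obtain C where C: "\<And>i j x. x \<ge> 0 \<Longrightarrow> \<bar>f i x * g' j x\<bar> \<le> C"
    using test by (auto simp: test_function_def)
  have G0: "0 \<le> G" using G[of 0 0] by (meson abs_ge_zero order_trans)
  have C0: "0 \<le> C" using C[of 0] by (meson abs_ge_zero order_refl order_trans)
  interpret prob_space \<mu> using inv by (simp add: invariant_prob_def)
  have s: "sets \<mu> = sets state_space" using inv by (simp add: invariant_prob_def)
  note [measurable_cong] = s
  have sp: "space \<mu> = {0..} \<times> env_states"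
    using sets_eq_imp_space_eq[OF s] by (simp add: space_state_space)
  have gm: "g j \<in> borel_measurable borel" for j
    by (intro borel_measurable_continuous_onI continuous_at_imp_continuous_on)
      (use g DERIV_isCont in blast)
  have g'm: "g' j \<in> borel_measurable borel" for j
    by (intro borel_measurable_continuous_onI g')
  let ?g = "\<lambda>z. g (snd z) (fst z)"
  have gz [measurable]: "?g \<in> borel_measurable state_space"
    by (rule measurable_state_space) (rule gm)
  \<comment> \<open>Times in (0, 1], since the derivative at 0 was taken within
    \<open>{0..1}\<close>.\<close>
  define t where "t n = 1 / real (Suc n)" for n
  have t: "0 < t n" "t n \<le> 1" for n by (auto simp: t_def)
  have tlim: "filterlim t (at 0 within {0..1}) sequentially"
    unfolding filterlim_at using t LIMSEQ_inverse_real_of_nat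
    by (auto simp: t_def[abs_def] inverse_eq_divide less_imp_le)
  define E where "E n z = g (snd z) (flow (snd z) (fst z) (t n))
     + (1 - exp (- (r (snd z) * t n))) * (g (- snd z) (fst z) - g (snd z) (flow (snd z) (fst z) (t n)))" for n z
  define L where "L n z = (E n z - ?g z) / t n" for n z
  have flow_m [measurable]: "(\<lambda>x. flow i x s) \<in> borel_measurable borel" for i s
    using measurable_compose[of "\<lambda>x. (x, \<lambda>_. 0)" borel "borel \<Otimes>\<^sub>M time_space", OF _ measurable_position]
    by (simp add: flow_def space_PiM)
  have Em [measurable]: "E n \<in> borel_measurable \<mu>" for n
  proof -
    have "(\<lambda>z. (\<lambda>i x. g i (flow i x (t n)) + (1 - exp (- (r i * t n))) * (g (- i) x - g i (flow i x (t n)))) (snd z) (fst z))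
        \<in> borel_measurable state_space"
      by (rule measurable_state_space) (use gm in measurable)
    then show ?thesis by (simp add: E_def[abs_def] cong: measurable_cong_sets[OF s refl])
  qed
  \<comment> \<open>Written with \<open>bind\<close>, invariance on sets passes to bounded
    integrands at once.\<close>
  have bind: "\<mu> \<bind> pdmp_kernel f r (t n) = \<mu>" for n
  proof (rule measure_eqI)
    have K: "pdmp_kernel f r (t n) \<in> measurable \<mu> (subprob_algebra state_space)"
      using measurable_kernel[of "t n"] t(1)[of n] by (simp add: less_imp_le cong: measurable_cong_sets[OF s refl])
    show se: "sets (\<mu> \<bind> pdmp_kernel f r (t n)) = sets \<mu>"
      by (subst sets_bind[of _ _ state_space]) (auto simp: s not_empty pdmp_kernel_def)
    fix A assume "A \<in> sets (\<mu> \<bind> pdmp_kernel f r (t n))"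
    then have "A \<in> sets state_space" using se s by simp
    then show "emeasure (\<mu> \<bind> pdmp_kernel f r (t n)) A = emeasure \<mu> A"
      using inv t(1)[of n] by (subst emeasure_bind[OF not_empty K]) (auto simp: invariant_prob_def less_imp_le)
  qed
  have bound: "\<bar>\<integral>z. L n z \<partial>\<mu>\<bar> \<le> (C * (l\<^sub>m + l\<^sub>p) + 2 * G * (l\<^sub>m + l\<^sub>p) * (l\<^sub>m + l\<^sub>p)) * t n" for n
  proof -
    let ?I = "\<lambda>z. \<integral>y. ?g y \<partial>pdmp_kernel f r (t n) z"
    let ?c = "C * (l\<^sub>m + l\<^sub>p) + 2 * G * (l\<^sub>m + l\<^sub>p) * (l\<^sub>m + l\<^sub>p)"
    have K [measurable]: "pdmp_kernel f r (t n) \<in> measurable \<mu> (subprob_algebra state_space)"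
      using measurable_kernel[of "t n"] t(1)[of n] by (simp add: less_imp_le cong: measurable_cong_sets[OF s refl])
    have Im [measurable]: "?I \<in> borel_measurable \<mu>"
      using measurable_compose[OF K integral_measurable_subprob_algebra[OF gz]] by simp
    have "(\<integral>z. ?I z \<partial>\<mu>) = integral\<^sup>L (\<mu> \<bind> pdmp_kernel f r (t n)) ?g"
    proof (rule integral_bind[OF gz _ K, symmetric, where B' = 1])
      show "\<bar>?g x\<bar> \<le> G" for x by (rule G)
      show "AE x in \<mu>. emeasure (pdmp_kernel f r (t n) x) (space (pdmp_kernel f r (t n) x)) \<le> ennreal 1"
        using subprob_space.subprob_emeasure_le_1[OF subprob_space_kernel[OF K]] by simp
    qed unfold_locales
    then have eq: "(\<integral>z. ?I z \<partial>\<mu>) = (\<integral>z. ?g z \<partial>\<mu>)" by (simp add: bind)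
    have b: "\<bar>?I z - E n z\<bar> \<le> ?c * (t n)\<^sup>2" if "z \<in> space \<mu>" for z
    proof -
      have z: "snd z \<in> env_states" "fst z \<ge> 0" using that by (auto simp: sp)
      have r: "r i \<le> l\<^sub>m + l\<^sub>p" "0 \<le> r i" for i using l by (auto simp: switch_rate_def)
      have "\<bar>?I (fst z, snd z) - E n z\<bar> \<le> (C * r (snd z) + 2 * G * r (snd z) * r (- snd z)) * (t n)\<^sup>2"
        unfolding E_def by (rule kernel_expansion[OF z less_imp_le[OF t(1)] g G C])
      also have "\<dots> \<le> ?c * (t n)\<^sup>2"
        using C0 G0 r l by (intro mult_right_mono add_mono mult_mono mult_nonneg_nonneg) auto
      finally show ?thesis by simp
    qed
    have EG: "\<bar>E n z\<bar> \<le> 3 * G" for z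
    proof -
      define y where "y = 1 - exp (- (r (snd z) * t n))"
      have y: "0 \<le> y" "y \<le> 1" using t(1)[of n] rate_pos[of "snd z"] by (auto simp: y_def)
      have "\<bar>y * (g (- snd z) (fst z) - g (snd z) (flow (snd z) (fst z) (t n)))\<bar> \<le> 1 * (2 * G)"
        unfolding abs_mult using y
        by (intro mult_mono)
          (use G[of "- snd z" "fst z"] G[of "snd z" "flow (snd z) (fst z) (t n)"] in auto)
      then show ?thesis
        using G[of "snd z" "flow (snd z) (fst z) (t n)"] unfolding E_def y_def by simp
    qed
    have Ei: "integrable \<mu> (E n)"
      by (rule integrable_const_bound[of _ "3 * G"]) (use EG in auto)
    have Ii: "integrable \<mu> ?I"
    proof (rule integrable_const_bound[of _ "?c * (t n)\<^sup>2 + 3 * G"])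
      show "AE z in \<mu>. norm (?I z) \<le> ?c * (t n)\<^sup>2 + 3 * G"
      proof (rule AE_I2)
        fix z assume "z \<in> space \<mu>"
        then show "norm (?I z) \<le> ?c * (t n)\<^sup>2 + 3 * G"
          using b[of z] EG[of z] by simp
      qed
    qed simp
    have gi: "integrable \<mu> ?g"
      by (rule integrable_const_bound[of _ G]) (use G in auto)
    have d: "(\<integral>z. E n z - ?g z \<partial>\<mu>) = (\<integral>z. E n z - ?I z \<partial>\<mu>)"
      by (simp only: Bochner_Integration.integral_diff[OF Ei Ii] Bochner_Integration.integral_diff[OF Ei gi] eq)
    have "\<bar>\<integral>z. E n z - ?I z \<partial>\<mu>\<bar> \<le> (\<integral>z. \<bar>E n z - ?I z\<bar> \<partial>\<mu>)"
      by (rule integral_abs_bound)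
    also have "\<dots> \<le> (\<integral>z. ?c * (t n)\<^sup>2 \<partial>\<mu>)"
    proof (rule integral_mono)
      show "integrable \<mu> (\<lambda>z. \<bar>E n z - ?I z\<bar>)"
        by (intro integrable_abs Bochner_Integration.integrable_diff Ei Ii)
      show "\<bar>E n z - ?I z\<bar> \<le> ?c * (t n)\<^sup>2" if "z \<in> space \<mu>" for z
        using b[OF that] by (simp only: abs_minus_commute)
    qed (rule integrable_const)
    also have "\<dots> = ?c * (t n)\<^sup>2" by (simp add: prob_space)
    finally have "\<bar>\<integral>z. E n z - ?g z \<partial>\<mu>\<bar> \<le> ?c * (t n)\<^sup>2" by (simp only: d)
    then have "\<bar>\<integral>z. E n z - ?g z \<partial>\<mu>\<bar> / t n \<le> ?c * (t n)\<^sup>2 / t n"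
      using t(1)[of n] by (intro divide_right_mono) auto
    then show ?thesis using t(1)[of n] by (simp add: L_def power2_eq_square)
  qed
  have lim: "(\<lambda>n. \<integral>z. L n z \<partial>\<mu>) \<longlonglongrightarrow> (\<integral>z. generator g g' (snd z) (fst z) \<partial>\<mu>)"
  proof (rule integral_dominated_convergence)
    show "(\<lambda>z. generator g g' (snd z) (fst z)) \<in> borel_measurable \<mu>"
    proof -
      have "(\<lambda>z. generator g g' (snd z) (fst z)) \<in> borel_measurable state_space"
        unfolding generator_def logistic_field_def
        by (rule measurable_state_space) (use gm g'm in measurable)
      then show ?thesis by (simp cong: measurable_cong_sets[OF s refl])
    qed
    show "L n \<in> borel_measurable \<mu>" for n unfolding L_def by measurable
    show "integrable \<mu> (\<lambda>_. C + (l\<^sub>m + l\<^sub>p) * (2 * G))" by simp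
    \<comment> \<open>Rearranged as a mixture of a flow increment and a jump increment; either part
      converges and is bounded by itself.\<close>
    have Leq: "L n z = exp (- (r (snd z) * t n)) * ((g (snd z) (flow (snd z) (fst z) (t n)) - ?g z) / t n)
        + (1 - exp (- (r (snd z) * t n))) / t n * (g (- snd z) (fst z) - ?g z)" for n z
      using t(1)[of n] by (simp add: L_def E_def field_simps)
    show "AE z in \<mu>. (\<lambda>n. L n z) \<longlonglongrightarrow> generator g g' (snd z) (fst z)"
    proof (rule AE_I2)
      fix z assume "z \<in> space \<mu>"
      then have x: "fst z \<ge> 0" by (auto simp: sp)
      define i where "i = snd z"
      have "((\<lambda>s. (g i (flow i (fst z) s) - g i (flow i (fst z) 0)) / (s - 0)) \<longlongrightarrow> f i (fst z) * g' i (fst z)) (at 0 within {0..1})"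
        using test_flow_deriv[OF g g' x, of i i] unfolding has_field_derivative_iff .
      then have 1: "((\<lambda>s. (g i (flow i (fst z) s) - g i (fst z)) / s) \<longlongrightarrow> f i (fst z) * g' i (fst z)) (at 0 within {0..1})"
        by (simp add: flow_def position_def)
      have 2: "((\<lambda>s. exp (- (r i * s))) \<longlongrightarrow> exp (- (r i * 0))) (at 0 within {0..1})"
        by (intro tendsto_intros)
      have "((\<lambda>s. exp (- (r i * s)) * ((g i (flow i (fst z) s) - g i (fst z)) / s)
          + (1 - exp (- (r i * s))) / s * (g (- i) (fst z) - g i (fst z))) \<longlongrightarrow>
         exp (- (r i * 0)) * (f i (fst z) * g' i (fst z)) + r i * (g (- i) (fst z) - g i (fst z))) (at 0 within {0..1})"
        by (intro tendsto_add tendsto_mult 1 2 exp_quotient_tendsto tendsto_const)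
      from filterlim_compose[OF this tlim] show "(\<lambda>n. L n z) \<longlonglongrightarrow> generator g g' (snd z) (fst z)"
        by (simp add: Leq generator_def i_def)
    qed
    show "AE z in \<mu>. norm (L n z) \<le> C + (l\<^sub>m + l\<^sub>p) * (2 * G)" for n
    proof (rule AE_I2)
      fix z assume "z \<in> space \<mu>"
      then have x: "fst z \<ge> 0" by (auto simp: sp)
      have tn: "0 < t n" using t by simp
      have "\<bar>g (snd z) (flow (snd z) (fst z) (t n)) - ?g z\<bar> \<le> C * t n"
        unfolding flow_def by (rule test_path_bound[OF g C x less_imp_le[OF tn]])
      then have "\<bar>(g (snd z) (flow (snd z) (fst z) (t n)) - ?g z) / t n\<bar> \<le> C"
        using tn by (simp add: abs_divide field_simps)
      moreover have "exp (- (r (snd z) * t n)) \<le> 1"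
        using tn rate_pos[of "snd z"] by simp
      ultimately have 1: "\<bar>exp (- (r (snd z) * t n)) * ((g (snd z) (flow (snd z) (fst z) (t n)) - ?g z) / t n)\<bar> \<le> 1 * C"
        unfolding abs_mult by (intro mult_mono) auto
      have "1 - exp (- (r (snd z) * t n)) \<le> r (snd z) * t n"
        using exp_ge_add_one_self[of "- (r (snd z) * t n)"] by simp
      then have "(1 - exp (- (r (snd z) * t n))) / t n \<le> r (snd z)"
        using tn by (simp add: field_simps)
      also have "\<dots> \<le> l\<^sub>m + l\<^sub>p" using l by (simp add: switch_rate_def)
      finally have "\<bar>(1 - exp (- (r (snd z) * t n))) / t n\<bar> \<le> l\<^sub>m + l\<^sub>p"
        using tn \<open>exp (- (r (snd z) * t n)) \<le> 1\<close> by simp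
      then have 2: "\<bar>(1 - exp (- (r (snd z) * t n))) / t n * (g (- snd z) (fst z) - ?g z)\<bar> \<le> (l\<^sub>m + l\<^sub>p) * (2 * G)"
        unfolding abs_mult using G[of "- snd z" "fst z"] G[of "snd z" "fst z"] l
        by (intro mult_mono) auto
      show "norm (L n z) \<le> C + (l\<^sub>m + l\<^sub>p) * (2 * G)"
        unfolding Leq real_norm_def using 1 2 by linarith
    qed
  qed
  have "(\<lambda>n. (C * (l\<^sub>m + l\<^sub>p) + 2 * G * (l\<^sub>m + l\<^sub>p) * (l\<^sub>m + l\<^sub>p)) * t n) \<longlonglongrightarrow> (C * (l\<^sub>m + l\<^sub>p) + 2 * G * (l\<^sub>m + l\<^sub>p) * (l\<^sub>m + l\<^sub>p)) * 0"
    using tlim by (intro tendsto_mult tendsto_const) (simp add: filterlim_at)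
  then have c: "(\<lambda>n. (C * (l\<^sub>m + l\<^sub>p) + 2 * G * (l\<^sub>m + l\<^sub>p) * (l\<^sub>m + l\<^sub>p)) * t n) \<longlonglongrightarrow> 0"
    by (simp only: mult_zero_right)
  have "(\<lambda>n. \<integral>z. L n z \<partial>\<mu>) \<longlonglongrightarrow> 0"
    by (rule Lim_null_comparison[OF always_eventually c], unfold real_norm_def) (intro allI bound)
  with lim show ?thesis by (rule LIMSEQ_unique)
qed

end

section \<open>Compactly supported functions on the line\<close>

text \<open>The interval is carried explicitly, because later it has to lie inside
  \<open>{0<..<p\<^sub>p}\<close>, where the singular factors are continuous. For a > b only the
  zero function qualifies.\<close>

definition compactly_supported :: "(real \<Rightarrow> real) \<Rightarrow> real \<Rightarrow> real \<Rightarrow> bool" where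
  "compactly_supported u a b \<longleftrightarrow> continuous_on UNIV u \<and> (\<forall>x. x \<notin> {a..b} \<longrightarrow> u x = 0)"

lemma compactly_supported_measurable: "compactly_supported u a b \<Longrightarrow> u \<in> borel_measurable borel"
  by (simp add: compactly_supported_def borel_measurable_continuous_onI)

lemma compactly_supported_mono:
  "compactly_supported u a b \<Longrightarrow> a' \<le> a \<Longrightarrow> b \<le> b' \<Longrightarrow> compactly_supported u a' b'"
  by (auto simp: compactly_supported_def)

lemma compactly_supported_add:
  "compactly_supported u a b \<Longrightarrow> compactly_supported v a b \<Longrightarrow> compactly_supported (\<lambda>x. u x + v x) a b"
  by (auto simp: compactly_supported_def intro!: continuous_intros)

lemma compactly_supported_cmult:
  "compactly_supported u a b \<Longrightarrow> compactly_supported (\<lambda>x. c * u x) a b"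
  by (auto simp: compactly_supported_def intro!: continuous_intros)

text \<open>The factor \<open>h\<close> may be singular outside \<open>S\<close>: the product is
  continuous on \<open>S\<close> and vanishes off \<open>{a..b}\<close>, and these two open sets
  cover the line. This admits \<open>weight\<close> and reciprocals of the fields as
  factors.\<close>

lemma compactly_supported_mult:
  assumes u: "compactly_supported u a b" and h: "continuous_on S h" and S: "open S" "{a..b} \<subseteq> S"
  shows "compactly_supported (\<lambda>x. u x * h x) a b"
proof -
  have "continuous_on S (\<lambda>x. u x * h x)"
    using u h by (auto simp: compactly_supported_def intro!: continuous_intros elim: continuous_on_subset)
  moreover have "continuous_on (- {a..b}) (\<lambda>x. u x * h x)"
    by (rule continuous_on_eq[OF continuous_on_const[of _ 0]]) (use u in \<open>auto simp: compactly_supported_def\<close>)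
  ultimately have "continuous_on (S \<union> - {a..b}) (\<lambda>x. u x * h x)"
    by (rule continuous_on_open_Un[OF S(1) open_Compl[OF closed_atLeastAtMost]])
  moreover have "S \<union> - {a..b} = UNIV" using S(2) by auto
  ultimately show ?thesis using u by (auto simp: compactly_supported_def)
qed

lemma compactly_supported_bounded:
  assumes u: "compactly_supported u a b"
  shows "\<exists>B. \<forall>x. \<bar>u x\<bar> \<le> B"
proof -
  have "compact (u ` {a..b})"
    by (rule compact_continuous_image) (use u in \<open>auto simp: compactly_supported_def elim: continuous_on_subset\<close>)
  then obtain B where B: "\<And>x. x \<in> {a..b} \<Longrightarrow> \<bar>u x\<bar> \<le> B"
    by (metis bounded_iff compact_imp_bounded imageI real_norm_def)
  have "\<bar>u x\<bar> \<le> max B 0" for x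
    using B[of x] u by (cases "x \<in> {a..b}") (auto simp: compactly_supported_def)
  then show ?thesis by blast
qed

lemma compactly_supported_integrable:
  fixes M :: "real measure"
  assumes u: "compactly_supported u a b" and "finite_measure M" and M: "sets M = sets borel"
  shows "integrable M u"
proof -
  interpret finite_measure M by fact
  obtain B where "\<And>x. \<bar>u x\<bar> \<le> B" using compactly_supported_bounded[OF u] by blast
  then show ?thesis
    using compactly_supported_measurable[OF u] M
    by (intro integrable_const_bound[of _ B]) (auto cong: measurable_cong_sets)
qed

lemma compactly_supported_lborel:
  assumes u: "compactly_supported u a b"
  shows "integrable lborel u" "(\<integral>x. u x \<partial>lborel) = integral {a..b} u"
proof -
  have eq: "(\<lambda>x. indicator {a..b} x *\<^sub>R u x) = u"
    using u by (auto simp: compactly_supported_def indicator_def fun_eq_iff)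
  have i: "set_integrable lborel {a..b} u"
    by (rule borel_integrable_atLeastAtMost') (use u in \<open>auto simp: compactly_supported_def elim: continuous_on_subset\<close>)
  then show "integrable lborel u" unfolding set_integrable_def eq .
  show "(\<integral>x. u x \<partial>lborel) = integral {a..b} u"
    using set_borel_integral_eq_integral(2)[OF i] unfolding set_lebesgue_integral_def eq .
qed

text \<open>Outside \<open>{a..b}\<close> the antiderivative is locally constant, hence bounded on
  the whole line; it has compact support exactly when the integral of \<open>u\<close> vanishes.
  Test functions are produced this way.\<close>

lemma compactly_supported_antiderivative:
  assumes u: "compactly_supported u a b" and ab: "a \<le> b"
  obtains h where "\<And>x. (h has_real_derivative u x) (at x)" "\<And>x. x \<le> a \<Longrightarrow> h x = 0"
    "\<And>x. b \<le> x \<Longrightarrow> h x = integral {a..b} u" "\<exists>B. \<forall>x. \<bar>h x\<bar> \<le> B"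
proof -
  have "isCont u x" for x
    using u by (simp add: compactly_supported_def continuous_on_eq_continuous_at)
  then obtain F where F: "\<And>x. (F has_real_derivative u x) (at x)"
    using einterval_antiderivative[of "-\<infinity>" \<infinity> u] by (auto simp: has_real_derivative_iff_has_vector_derivative)
  define h where "h x = F x - F a" for x
  have h: "(h has_real_derivative u x) (at x)" for x
    unfolding h_def[abs_def] using DERIV_diff[OF F[of x] DERIV_const[of "F a"]] by simp
  have ch: "continuous_on S h" for S
    by (rule continuous_at_imp_continuous_on) (use h DERIV_isCont in blast)
  have const: "h y = h x" if "x \<le> y" "\<And>z. x < z \<Longrightarrow> z < y \<Longrightarrow> u z = 0" for x y
  proof (cases "x = y")
    case False
    then have "x < y" using that(1) by simp
    then show ?thesis
      by (rule DERIV_isconst_end[OF _ ch]) (use h that(2) in metis)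
  qed simp
  have ha: "h x = 0" if "x \<le> a" for x
    using const[OF that] u by (auto simp: compactly_supported_def h_def)
  have "(u has_integral (h b - h a)) {a..b}"
    by (rule fundamental_theorem_of_calculus[OF ab])
      (use h in \<open>auto simp: has_real_derivative_iff_has_vector_derivative[symmetric] intro: has_field_derivative_at_within\<close>)
  then have "integral {a..b} u = h b" using ha[of a] by (simp add: integral_unique)
  then have hb: "h x = integral {a..b} u" if "b \<le> x" for x
    using const[OF that] u by (auto simp: compactly_supported_def)
  have "compact (h ` {a..b})"
    by (rule compact_continuous_image[OF ch]) simp
  then obtain B where B: "\<And>x. x \<in> {a..b} \<Longrightarrow> \<bar>h x\<bar> \<le> B"
    by (metis bounded_iff compact_imp_bounded imageI real_norm_def)
  have "\<bar>h x\<bar> \<le> B" for x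
  proof -
    consider "x \<le> a" | "x \<in> {a..b}" | "b \<le> x" by fastforce
    then show ?thesis
      using B[of x] B[of a] B[of b] ha[of x] ha[of a] hb[of x] hb[of b] ab by cases auto
  qed
  then show ?thesis using that[OF h ha hb] by blast
qed

text \<open>A finite measure on the line is fixed by its values on open rays. Concentration on (0,
  p) turns a ray into an interval \<open>{c<..<p}\<close>, whose indicator is an increasing limit of
  trapezoids supported inside. Nonnegative integrals are used because integrability of
  \<open>\<rho>\<close> up to the ends is a consequence, not an assumption.\<close>

lemma density_eqI_compactly_supported:
  fixes m :: "real measure"
  assumes fin: "finite_measure m" and m: "sets m = sets borel" and p: "0 < p"
    and AE: "AE x in m. 0 < x \<and> x < p"
    and \<rho>: "continuous_on {0<..<p} \<rho>" "\<And>x. 0 \<le> \<rho> x" "\<And>x. x \<notin> {0<..<p} \<Longrightarrow> \<rho> x = 0"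
    and eq: "\<And>v a b. compactly_supported v a b \<Longrightarrow> 0 < a \<Longrightarrow> a \<le> b \<Longrightarrow> b < p \<Longrightarrow>
      (\<integral>x. v x \<partial>m) = (\<integral>x. v x * \<rho> x \<partial>lborel)"
  shows "m = density lborel (\<lambda>x. ennreal (\<rho> x))"
proof (rule measure_eqI_lessThan)
  interpret finite_measure m by fact
  note [measurable_cong] = m
  have [measurable]: "\<rho> \<in> borel_measurable borel"
  proof -
    have "(\<lambda>x. if x \<in> {0<..<p} then \<rho> x else 0) \<in> borel_measurable borel"
      by (rule borel_measurable_continuous_on_if) (use \<rho>(1) in auto)
    moreover have "(\<lambda>x. if x \<in> {0<..<p} then \<rho> x else 0) = \<rho>" using \<rho>(3) by auto
    ultimately show ?thesis by simp
  qed
  let ?N = "density lborel (\<lambda>x. ennreal (\<rho> x))"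
  show "sets m = sets borel" by fact
  show "sets ?N = sets borel" by simp
  show "emeasure m {x<..} < \<infinity>" for x by (simp add: less_top[symmetric])
  fix x :: real
  define c where "c = max x 0"
  have "AE y in ?N. 0 < y \<and> y < p"
  proof (subst AE_density)
    show "AE y in lborel. 0 < ennreal (\<rho> y) \<longrightarrow> 0 < y \<and> y < p"
      using \<rho>(3) by (intro AE_I2 impI) (metis greaterThanLessThan_iff ennreal_0 less_irrefl)
  qed simp
  then have N: "emeasure ?N {x<..} = emeasure ?N {c<..<p}"
    by (intro emeasure_eq_AE) (auto simp: c_def)
  have M: "emeasure m {x<..} = emeasure m {c<..<p}"
    using AE by (intro emeasure_eq_AE) (auto simp: c_def)
  have "emeasure m {c<..<p} = emeasure ?N {c<..<p}"
  proof (cases "c < p")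
    case True
    \<comment> \<open>The trapezoid vanishes within 1/(n+1) of either end and equals 1 at distance
      at least 2/(n+1) from both.\<close>
    define v where "v n y = max 0 (min 1 (min (real (Suc n) * (y - c) - 1) (real (Suc n) * (p - y) - 1)))" for n y
    have v0: "v n y = 0" if "y \<le> c \<or> p \<le> y" for n y
    proof -
      have "real (Suc n) * (y - c) \<le> 0 \<or> real (Suc n) * (p - y) \<le> 0"
        using that by (auto simp: mult_nonneg_nonpos)
      then show ?thesis by (auto simp: v_def)
    qed
    \<comment> \<open>The midpoint only keeps the bounds ordered and inside the interval when
      1/(n+1) exceeds half its length; the trapezoid is then 0.\<close>
    have vs: "compactly_supported (v n) (min (c + 1 / Suc n) ((c + p) / 2)) (max (p - 1 / Suc n) ((c + p) / 2))" for n
    proof -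
      have "continuous_on UNIV (v n)" unfolding v_def by (intro continuous_intros)
      moreover have "v n y = 0" if "y < c + 1 / Suc n \<or> p - 1 / Suc n < y" for y
      proof -
        have "real (Suc n) * (y - c) \<le> 1 \<or> real (Suc n) * (p - y) \<le> 1"
          using that by (auto simp: field_simps)
        then show ?thesis by (auto simp: v_def)
      qed
      ultimately show ?thesis by (auto simp: compactly_supported_def not_le)
    qed
    have sub: "{a..b} \<subseteq> {0<..<p}" if "0 < a" "b < p" for a b
      using that by auto
    have nn: "(\<integral>\<^sup>+y. ennreal (v n y) \<partial>m) = (\<integral>\<^sup>+y. ennreal (v n y) \<partial>?N)" for n
    proof -
      let ?a = "min (c + 1 / Suc n) ((c + p) / 2)" and ?b = "max (p - 1 / Suc n) ((c + p) / 2)"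
      have ab': "0 < min (c + e) ((c + p) / 2)" "min (c + e) ((c + p) / 2) \<le> max (p - e) ((c + p) / 2)"
        "max (p - e) ((c + p) / 2) < p" if "e > 0" for e
        using that True by (auto simp: c_def)
      have ab: "0 < ?a" "?a \<le> ?b" "?b < p" by (rule ab', simp)+
      have vp: "0 \<le> v n y" for y by (simp add: v_def)
      have s: "compactly_supported (\<lambda>y. v n y * \<rho> y) ?a ?b"
        by (rule compactly_supported_mult[OF vs \<rho>(1) open_greaterThanLessThan sub[OF ab(1,3)]])
      have [measurable]: "v n \<in> borel_measurable borel"
        by (rule compactly_supported_measurable[OF vs])
      have "(\<integral>\<^sup>+y. ennreal (v n y) \<partial>m) = ennreal (\<integral>y. v n y \<partial>m)"
        by (rule nn_integral_eq_integral[OF compactly_supported_integrable[OF vs fin m]]) (simp add: vp)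
      also have "\<dots> = ennreal (\<integral>y. v n y * \<rho> y \<partial>lborel)"
        using eq[OF vs ab] by simp
      also have "\<dots> = (\<integral>\<^sup>+y. ennreal (v n y * \<rho> y) \<partial>lborel)"
        by (rule nn_integral_eq_integral[symmetric, OF compactly_supported_lborel(1)[OF s]]) (simp add: vp \<rho>)
      also have "\<dots> = (\<integral>\<^sup>+y. ennreal (v n y) \<partial>?N)"
        by (subst nn_integral_density) (auto simp: ennreal_mult' \<rho>(2) vp mult.commute)
      finally show ?thesis .
    qed
    have lim: "(\<lambda>n. \<integral>\<^sup>+y. ennreal (v n y) \<partial>M) \<longlonglongrightarrow> (\<integral>\<^sup>+y. indicator {c<..<p} y \<partial>M)"
      if M: "sets M = sets borel" for M :: "real measure"
    proof (rule nn_integral_LIMSEQ)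
      show "incseq (\<lambda>n y. ennreal (v n y))"
      proof (intro incseq_SucI le_funI ennreal_leI)
        fix n y show "v n y \<le> v (Suc n) y"
        proof (cases "y \<le> c \<or> p \<le> y")
          case False
          then have "real (Suc n) * (y - c) \<le> real (Suc (Suc n)) * (y - c)"
            "real (Suc n) * (p - y) \<le> real (Suc (Suc n)) * (p - y)"
            by (auto intro!: mult_right_mono)
          then show ?thesis unfolding v_def by linarith
        qed (simp add: v0)
      qed
      show "(\<lambda>y. ennreal (v n y)) \<in> borel_measurable M" for n
        using compactly_supported_measurable[OF vs[of n]] M by (auto cong: measurable_cong_sets)
      show "(\<lambda>n. ennreal (v n y)) \<longlonglongrightarrow> indicator {c<..<p} y" for y
      proof (cases "y \<le> c \<or> p \<le> y")
        case False
        have ev: "\<forall>\<^sub>F n in sequentially. 2 \<le> real (Suc n) * d" if "d > 0" for d :: real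
        proof -
          obtain N where N: "2 < real N * d" using ex_less_of_nat_mult[OF \<open>d > 0\<close>] by blast
          show ?thesis
          proof (rule eventually_sequentiallyI[of N])
            fix n assume "N \<le> n"
            then have "real N * d \<le> real (Suc n) * d" using that by (intro mult_right_mono) auto
            with N show "2 \<le> real (Suc n) * d" by simp
          qed
        qed
        have "\<forall>\<^sub>F n in sequentially. 2 \<le> real (Suc n) * (y - c)" "\<forall>\<^sub>F n in sequentially. 2 \<le> real (Suc n) * (p - y)"
          by (rule ev, use False in simp)+
        then have "\<forall>\<^sub>F n in sequentially. ennreal (v n y) = indicator {c<..<p} y"
          by eventually_elim (use False in \<open>auto simp: v_def\<close>)
        then show ?thesis by (rule tendsto_eventually)
      qed (auto simp: v0)
    qed
    have "(\<integral>\<^sup>+y. indicator {c<..<p} y \<partial>m) = (\<integral>\<^sup>+y. indicator {c<..<p} y \<partial>?N)"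
      using LIMSEQ_unique[OF lim[OF m]] lim[of ?N] nn by simp
    then show ?thesis by (simp add: m)
  qed simp
  then show "emeasure m {x<..} = emeasure ?N {x<..}" using M N by simp
qed

section \<open>Stationary pairs of measures\<close>

text \<open>Squaring the positive part makes it C^1; composition with a concave parabola then gives
  C^1 bumps.\<close>

lemma max_square_deriv: "((\<lambda>z::real. (max 0 z)\<^sup>2) has_real_derivative 2 * max 0 z) (at z)"
proof -
  consider "z < 0" | "z = 0" | "z > 0" by linarith
  then show ?thesis
  proof cases
    case 1
    have "((\<lambda>z. 0) has_real_derivative 2 * max 0 z) (at z)" using 1 by simp
    then show ?thesis
      by (rule has_field_derivative_transform_within_open[where S = "{..<0}"]) (use 1 in auto)
  next
    case 2
    have "((\<lambda>h::real. (max 0 h)\<^sup>2 / h) \<longlongrightarrow> 0) (at 0)"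
    proof (rule Lim_null_comparison)
      have "norm ((max 0 h)\<^sup>2 / h) \<le> \<bar>h\<bar>" for h :: real
        by (auto simp: max_def power2_eq_square)
      then show "\<forall>\<^sub>F h in at 0. norm ((max 0 h)\<^sup>2 / h) \<le> \<bar>h::real\<bar>" by simp
      show "((\<lambda>h::real. \<bar>h\<bar>) \<longlongrightarrow> 0) (at 0)"
        using tendsto_rabs[OF tendsto_ident_at[of "0::real" UNIV]] by simp
    qed
    then show ?thesis using 2 by (simp add: has_field_derivative_iff)
  next
    case 3
    have "((\<lambda>z. z\<^sup>2) has_real_derivative 2 * max 0 z) (at z)"
      using 3 by (auto intro!: derivative_eq_intros)
    then show ?thesis
      by (rule has_field_derivative_transform_within_open[where S = "{0<..}"]) (use 3 in auto)
  qed
qed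

text \<open>Dominated convergence with a constant majorant. Applied to bumps shrinking to one point,
  it reads off an atom.\<close>

lemma integral_tendsto_point:
  fixes m :: "real measure"
  assumes "finite_measure m" and m: "sets m = sets borel"
    and s: "\<And>n. s n \<in> borel_measurable borel" "\<And>n x. \<bar>s n x\<bar> \<le> B"
    and lim: "\<And>x. (\<lambda>n. s n x) \<longlonglongrightarrow> c * indicator {p} x"
  shows "(\<lambda>n. \<integral>x. s n x \<partial>m) \<longlonglongrightarrow> c * measure m {p}"
proof -
  interpret finite_measure m by fact
  have sp: "{p} \<in> sets m" by (simp add: m)
  have "(\<lambda>n. \<integral>x. s n x \<partial>m) \<longlonglongrightarrow> (\<integral>x. c * indicator {p} x \<partial>m)"
  proof (rule integral_dominated_convergence)
    show "(\<lambda>x. c * indicator {p} x) \<in> borel_measurable m" using sp by measurable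
    show "s n \<in> borel_measurable m" for n using s(1) m by (simp cong: measurable_cong_sets)
    show "integrable m (\<lambda>_. B)" by simp
  qed (use s lim in auto)
  then show ?thesis using sp by simp
qed

context logistic_switching
begin

lemma field_1 [simp]: "f 1 x = x * (p\<^sub>p - x)" and field_m1 [simp]: "f (-1) x = - (x * (x - p\<^sub>m))"
  by (auto simp: logistic_field_def power2_eq_square algebra_simps)

lemma rate_1 [simp]: "r 1 = l\<^sub>p" and rate_m1 [simp]: "r (-1) = l\<^sub>m"
  by (auto simp: switch_rate_def)

lemma continuous_field: "continuous_on S (f i)"
  unfolding logistic_field_def by (intro continuous_intros)

text \<open>Compactly supported derivatives tame the quadratic growth of the fields. Every label
  other than 1 shares the second component, in accordance with the fields, which take only two forms
  over all integers.\<close>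

lemma test_functionI:
  assumes A: "\<And>x. (A has_real_derivative A' x) (at x)" "compactly_supported A' a b" "\<exists>c. \<forall>x. \<bar>A x\<bar> \<le> c"
    and B: "\<And>x. (B has_real_derivative B' x) (at x)" "compactly_supported B' a b" "\<exists>c. \<forall>x. \<bar>B x\<bar> \<le> c"
  shows "test_function (\<lambda>j. if j = 1 then A else B) (\<lambda>j. if j = 1 then A' else B')"
proof -
  have bd: "\<exists>c. \<forall>x. \<bar>f i x * u x\<bar> \<le> c" if "compactly_supported u a b" for i u
    using compactly_supported_bounded[OF compactly_supported_mult[OF that continuous_field[of UNIV i]]]
    by (simp add: mult.commute)
  obtain c1 c2 c3 c4 where c: "\<And>x. \<bar>f 1 x * A' x\<bar> \<le> c1" "\<And>x. \<bar>f (-1) x * A' x\<bar> \<le> c2"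
    "\<And>x. \<bar>f 1 x * B' x\<bar> \<le> c3" "\<And>x. \<bar>f (-1) x * B' x\<bar> \<le> c4"
    using bd[OF A(2)] bd[OF B(2)] by meson
  have fi: "f i = f 1 \<or> f i = f (-1)" for i by (auto simp: logistic_field_def fun_eq_iff)
  have "\<bar>f i x * A' x\<bar> \<le> max (max c1 c2) (max c3 c4)" "\<bar>f i x * B' x\<bar> \<le> max (max c1 c2) (max c3 c4)" for i x
    using fi[of i] c[of x] by (auto simp del: field_1 field_m1 simp: le_max_iff_disj)
  then have "\<exists>C. \<forall>i j. \<forall>x\<ge>0. \<bar>f i x * (if j = (1::int) then A' else B') x\<bar> \<le> C"
    by (intro exI[of _ "max (max c1 c2) (max c3 c4)"]) auto
  moreover obtain d1 d2 where "\<And>x. \<bar>A x\<bar> \<le> d1" "\<And>x. \<bar>B x\<bar> \<le> d2" using A(3) B(3) by blast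
  then have "\<exists>G. \<forall>j x. \<bar>(if j = (1::int) then A else B) x\<bar> \<le> G"
    by (intro exI[of _ "max d1 d2"]) (auto simp: le_max_iff_disj)
  ultimately show ?thesis
    using A B by (auto simp: test_function_def compactly_supported_def)
qed

end

text \<open>What remains of the process: finite measures on the whole line, those at 1 and -1 being
  tied by one family of identities. Forgetting the state space allows ordinary analysis on the
  line.\<close>

locale stationary_pair = logistic_switching +
  fixes m :: "int \<Rightarrow> real measure"
  assumes fin: "\<And>i. finite_measure (m i)" and sets: "\<And>i. sets (m i) = sets borel"
    and pos: "\<And>i. AE x in m i. 0 < x"
    and stationary: "\<And>g g'. test_function g g' \<Longrightarrow>
      (\<integral>x. generator g g' 1 x \<partial>m 1) + (\<integral>x. generator g g' (-1) x \<partial>m (-1)) = 0"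
begin

sublocale M: finite_measure "m i" for i by (rule fin)

section \<open>Flux balance and the support of the two measures\<close>

text \<open>Every compactly supported \<open>u\<close> is the derivative of a bounded function, and
  with that function in both components the switching terms cancel.\<close>

lemma flux_balance:
  assumes u: "compactly_supported u a b"
  shows "(\<integral>x. u x * f 1 x \<partial>m 1) + (\<integral>x. u x * f (-1) x \<partial>m (-1)) = 0"
proof (cases "a \<le> b")
  case True
  obtain h where h: "\<And>x. (h has_real_derivative u x) (at x)" "\<exists>B. \<forall>x. \<bar>h x\<bar> \<le> B"
    using compactly_supported_antiderivative[OF u True] by metis
  show ?thesis
    using stationary[OF test_functionI[OF h(1) u h(2) h(1) u h(2)]]
    by (simp add: generator_def mult.commute)
next
  case False
  then have "u x = 0" for x using u by (auto simp: compactly_supported_def)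
  then show ?thesis by simp
qed

text \<open>Both summands of the flux balance are nonpositive there, so each vanishes; strict
  negativity of the field leaves no mass where \<open>u\<close> is positive.\<close>

lemma AE_le_carrying_capacity:
  assumes i: "i \<in> env_states" shows "AE x in m i. x \<le> p\<^sub>p"
proof -
  have *: "AE x in m i. \<not> (p\<^sub>p < x \<and> x < p\<^sub>p + real n)" for n
  proof -
    \<comment> \<open>A tent positive exactly on the open interval from \<open>p\<^sub>p\<close> to
      \<open>p\<^sub>p + n\<close>; countably many of them exhaust the region beyond
      \<open>p\<^sub>p\<close>.\<close>
    define u where "u x = max 0 (min (x - p\<^sub>p) (p\<^sub>p + real n - x))" for x
    have u: "compactly_supported u p\<^sub>p (p\<^sub>p + real n)"
      unfolding compactly_supported_def u_def by (auto intro!: continuous_intros)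
    have uf: "compactly_supported (\<lambda>x. u x * f i x) p\<^sub>p (p\<^sub>p + real n)" for i
      by (rule compactly_supported_mult[OF u continuous_field[of UNIV]]) auto
    have int: "integrable (m i) (\<lambda>x. u x * f i x)" for i
      by (rule compactly_supported_integrable[OF uf fin sets])
    have nonpos: "u x * f i x \<le> 0" if "i \<in> env_states" for i x
    proof (cases "p\<^sub>p < x \<and> x < p\<^sub>p + real n")
      case True
      then have "f i x \<le> 0" using p that by (auto simp: env_states_def mult_nonneg_nonpos)
      then show ?thesis by (simp add: u_def mult_nonneg_nonpos)
    qed (auto simp: u_def)
    have "(\<integral>x. u x * f i x \<partial>m i) \<le> 0" if "i \<in> env_states" for i
      using integral_nonneg_AE[where M = "m i" and f = "\<lambda>x. - (u x * f i x)"] nonpos[OF that] by simp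
    from this[of 1] this[of "-1"] have "(\<integral>x. u x * f i x \<partial>m i) = 0"
      using flux_balance[OF u] i unfolding env_states_def by fastforce
    then have "AE x in m i. - (u x * f i x) = 0"
      using integral_nonneg_eq_0_iff_AE[where M = "m i" and f = "\<lambda>x. - (u x * f i x)"] int nonpos[OF i] by simp
    then show ?thesis
    proof eventually_elim
      case (elim x)
      show ?case
      proof
        assume x: "p\<^sub>p < x \<and> x < p\<^sub>p + real n"
        then have "0 < u x" by (simp add: u_def)
        then have "u x \<noteq> 0" by simp
        moreover have "f i x \<noteq> 0" using x p i by (auto simp: env_states_def)
        ultimately show False using elim by simp
      qed
    qed
  qed
  have "AE x in m i. \<forall>n. \<not> (p\<^sub>p < x \<and> x < p\<^sub>p + real n)"
    unfolding AE_all_countable by (intro allI *)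
  then show ?thesis
  proof eventually_elim
    case (elim x)
    obtain n where "x - p\<^sub>p < real n" using reals_Archimedean2 by blast
    then show ?case using elim by (metis add.commute less_diff_eq not_le diff_less_eq)
  qed
qed

text \<open>Concentrated at \<open>p\<^sub>p\<close>, the flux balance removes the atom of
  \<open>m (-1)\<close>, as \<open>f (-1)\<close> is nonzero there, but says nothing about
  \<open>m 1\<close>. A bump in the component 1 alone settles that one: in the limit only the
  switching terms are left, and they equate multiples of the two atoms.\<close>

lemma no_atom:
  assumes "i \<in> env_states" shows "measure (m i) {p\<^sub>p} = 0"
proof -
  \<comment> \<open>The rescaled signed distance; the bump \<open>k n\<close> has height 1 and is
    supported where its modulus is at most 1.\<close>
  define y where "y n x = real (Suc n) * (x - p\<^sub>p)" for n x
  define k where "k n x = (max 0 (1 - (y n x)\<^sup>2))\<^sup>2" for n x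
  define k' where "k' n x = 2 * max 0 (1 - (y n x)\<^sup>2) * (- (2 * real (Suc n) * y n x))" for n x
  have dk: "(k n has_real_derivative k' n x) (at x)" for n x
  proof -
    have "((\<lambda>x. 1 - (y n x)\<^sup>2) has_real_derivative (- (2 * real (Suc n) * y n x))) (at x)"
      unfolding y_def by (auto intro!: derivative_eq_intros)
    from DERIV_chain2[OF max_square_deriv this] show ?thesis
      unfolding k_def[abs_def] k'_def .
  qed
  have small: "\<bar>x - p\<^sub>p\<bar> \<le> 1" if "max 0 (1 - (y n x)\<^sup>2) \<noteq> 0" for n x
  proof -
    have "\<bar>y n x\<bar> \<le> 1" using that by (simp add: abs_le_square_iff[of _ 1, simplified])
    then have le: "real (Suc n) * \<bar>x - p\<^sub>p\<bar> \<le> 1" by (simp add: y_def abs_mult)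
    have "1 * \<bar>x - p\<^sub>p\<bar> \<le> real (Suc n) * \<bar>x - p\<^sub>p\<bar>" by (intro mult_right_mono) auto
    from order_trans[OF this le] show ?thesis by simp
  qed
  have k01: "0 \<le> k n x" "k n x \<le> 1" for n x
    by (auto simp: k_def power_le_one)
  have cs: "compactly_supported (k n) (p\<^sub>p - 1) (p\<^sub>p + 1)" "compactly_supported (k' n) (p\<^sub>p - 1) (p\<^sub>p + 1)" for n
  proof -
    have "max 0 (1 - (y n x)\<^sup>2) = 0" if "x \<notin> {p\<^sub>p - 1..p\<^sub>p + 1}" for x
      by (rule ccontr, drule small) (use that in \<open>auto simp: abs_le_iff\<close>)
    then show "compactly_supported (k n) (p\<^sub>p - 1) (p\<^sub>p + 1)" "compactly_supported (k' n) (p\<^sub>p - 1) (p\<^sub>p + 1)"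
      unfolding compactly_supported_def k_def k'_def by (auto intro!: continuous_intros simp: y_def)
  qed
  have z: "compactly_supported (\<lambda>_. 0) (p\<^sub>p - 1) (p\<^sub>p + 1)" by (simp add: compactly_supported_def)
  have ev: "\<forall>\<^sub>F n in sequentially. max 0 (1 - (y n x)\<^sup>2) = 0" if "x \<noteq> p\<^sub>p" for x
  proof -
    have "0 < \<bar>x - p\<^sub>p\<bar>" using that by simp
    then obtain N where N: "1 < real N * \<bar>x - p\<^sub>p\<bar>" using ex_less_of_nat_mult by blast
    show ?thesis
    proof (rule eventually_sequentiallyI[of N])
      fix n assume "N \<le> n"
      then have "real N * \<bar>x - p\<^sub>p\<bar> \<le> real (Suc n) * \<bar>x - p\<^sub>p\<bar>" by (intro mult_right_mono) auto
      with N have "1 \<le> \<bar>y n x\<bar>" by (simp add: y_def abs_mult)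
      then show "max 0 (1 - (y n x)\<^sup>2) = 0" using abs_le_square_iff[of 1 "y n x"] by simp
    qed
  qed
  have klim: "(\<lambda>n. k n x) \<longlonglongrightarrow> indicator {p\<^sub>p} x" for x
  proof (cases "x = p\<^sub>p")
    case False
    have "\<forall>\<^sub>F n in sequentially. k n x = indicator {p\<^sub>p} x"
      using ev[OF False] by eventually_elim (simp add: k_def False)
    then show ?thesis by (rule tendsto_eventually)
  qed (simp add: k_def y_def)
  have k'lim: "(\<lambda>n. k' n x) \<longlonglongrightarrow> 0" for x
  proof (cases "x = p\<^sub>p")
    case False
    have "\<forall>\<^sub>F n in sequentially. k' n x = 0"
      using ev[OF False] by eventually_elim (simp add: k'_def)
    then show ?thesis by (rule tendsto_eventually)
  qed (simp add: k'_def y_def)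
  have fb: "\<exists>c. \<forall>n x. \<bar>k n x * f i x\<bar> \<le> c" for i
  proof -
    \<comment> \<open>One fixed tent dominates all bumps: it is at least 1 wherever some
      \<open>k n\<close> is positive.\<close>
    have "compactly_supported (\<lambda>x. max 0 (2 - \<bar>x - p\<^sub>p\<bar>) * f i x) (p\<^sub>p - 2) (p\<^sub>p + 2)"
      by (rule compactly_supported_mult[OF _ continuous_field[of UNIV]])
        (auto simp: compactly_supported_def intro!: continuous_intros)
    then obtain c where c: "\<And>x. \<bar>max 0 (2 - \<bar>x - p\<^sub>p\<bar>) * f i x\<bar> \<le> c"
      using compactly_supported_bounded by blast
    have "\<bar>k n x * f i x\<bar> \<le> c" for n x
    proof -
      have "k n x \<le> max 0 (2 - \<bar>x - p\<^sub>p\<bar>)"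
      proof (cases "max 0 (1 - (y n x)\<^sup>2) = 0")
        case False
        then show ?thesis using k01(2)[of n x] small[OF False] by linarith
      qed (simp add: k_def)
      then have "\<bar>k n x * f i x\<bar> \<le> \<bar>max 0 (2 - \<bar>x - p\<^sub>p\<bar>) * f i x\<bar>"
        unfolding abs_mult using k01(1)[of n x] by (intro mult_right_mono) auto
      then show ?thesis using c[of x] by linarith
    qed
    then show ?thesis by blast
  qed
  \<comment> \<open>\<open>k' n\<close> is of order n, but on a window of width of order 1/n around
    the zero of \<open>f 1\<close>. The product is 4 x times a number in [0, 1], and x is at most
    \<open>p\<^sub>p + 1\<close> on the window.\<close>
  have k'b: "\<bar>f 1 x * k' n x\<bar> \<le> 4 * (p\<^sub>p + 1)" for n x
  proof (cases "max 0 (1 - (y n x)\<^sup>2) = 0")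
    case False
    define M where "M = max 0 (1 - (y n x)\<^sup>2)"
    have M: "0 \<le> M" "M \<le> 1" "(y n x)\<^sup>2 \<le> 1" using False by (auto simp: M_def)
    have x: "\<bar>x\<bar> \<le> p\<^sub>p + 1" using small[OF False] p by linarith
    have "f 1 x * k' n x = 4 * (x * (M * (y n x)\<^sup>2))"
      by (simp add: k'_def M_def y_def power2_eq_square algebra_simps)
    also have "\<bar>\<dots>\<bar> = 4 * (\<bar>x\<bar> * (M * (y n x)\<^sup>2))" using M by (simp add: abs_mult)
    also have "\<dots> \<le> 4 * ((p\<^sub>p + 1) * (1 * 1))"
      using M x p by (intro mult_left_mono mult_mono) auto
    finally show ?thesis by simp
  qed (use p in \<open>simp add: k'_def\<close>)
  have mk: "k n \<in> borel_measurable borel" "k' n \<in> borel_measurable borel" "f i \<in> borel_measurable borel" for n i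
    by (rule compactly_supported_measurable[OF cs(1)] compactly_supported_measurable[OF cs(2)]
        borel_measurable_continuous_onI[OF continuous_field])+
  have Lf: "(\<lambda>n. \<integral>x. k n x * f i x \<partial>m i) \<longlonglongrightarrow> f i p\<^sub>p * measure (m i) {p\<^sub>p}" for i
  proof -
    obtain c where c: "\<And>n x. \<bar>k n x * f i x\<bar> \<le> c" using fb by blast
    show ?thesis
    proof (rule integral_tendsto_point[OF fin sets _ c])
      show "(\<lambda>x. k n x * f i x) \<in> borel_measurable borel" for n using mk by measurable
      show "(\<lambda>n. k n x * f i x) \<longlonglongrightarrow> f i p\<^sub>p * indicator {p\<^sub>p} x" for x
        using tendsto_mult[OF klim[of x] tendsto_const[of "f i x"]] by (auto simp: indicator_def split: if_splits)
    qed
  qed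
  have "(\<lambda>n. (\<integral>x. k n x * f 1 x \<partial>m 1) + (\<integral>x. k n x * f (-1) x \<partial>m (-1))) \<longlonglongrightarrow>
      f 1 p\<^sub>p * measure (m 1) {p\<^sub>p} + f (-1) p\<^sub>p * measure (m (-1)) {p\<^sub>p}"
    by (intro tendsto_add Lf)
  then have "f 1 p\<^sub>p * measure (m 1) {p\<^sub>p} + f (-1) p\<^sub>p * measure (m (-1)) {p\<^sub>p} = 0"
    using flux_balance[OF cs(1)] by (simp add: LIMSEQ_const_iff)
  then have m2: "measure (m (-1)) {p\<^sub>p} = 0" using p by auto
  have gen: "(\<integral>x. f 1 x * k' n x - l\<^sub>p * k n x \<partial>m 1) + (\<integral>x. l\<^sub>m * k n x \<partial>m (-1)) = 0" for n
  proof -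
    have "\<exists>c. \<forall>x. \<bar>k n x\<bar> \<le> c" using k01 by (intro exI[of _ 1]) simp
    moreover have "\<exists>c. \<forall>x::real. \<bar>0::real\<bar> \<le> c" by auto
    ultimately have "test_function (\<lambda>j. if j = 1 then k n else (\<lambda>_. 0)) (\<lambda>j. if j = 1 then k' n else (\<lambda>_. 0))"
      by (intro test_functionI[OF dk cs(2) _ DERIV_const z])
    from stationary[OF this]
    show ?thesis by (simp add: generator_def del: field_1)
  qed
  have "(\<lambda>n. (\<integral>x. f 1 x * k' n x - l\<^sub>p * k n x \<partial>m 1) + (\<integral>x. l\<^sub>m * k n x \<partial>m (-1))) \<longlonglongrightarrow>
      (- l\<^sub>p) * measure (m 1) {p\<^sub>p} + l\<^sub>m * measure (m (-1)) {p\<^sub>p}"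
  proof (rule tendsto_add)
    show "(\<lambda>n. \<integral>x. f 1 x * k' n x - l\<^sub>p * k n x \<partial>m 1) \<longlonglongrightarrow> (- l\<^sub>p) * measure (m 1) {p\<^sub>p}"
    proof (rule integral_tendsto_point[OF fin sets])
      show "(\<lambda>x. f 1 x * k' n x - l\<^sub>p * k n x) \<in> borel_measurable borel" for n using mk by measurable
      show "\<bar>f 1 x * k' n x - l\<^sub>p * k n x\<bar> \<le> 4 * (p\<^sub>p + 1) + l\<^sub>p" for n x
      proof -
        have "\<bar>l\<^sub>p * k n x\<bar> \<le> l\<^sub>p" using k01[of n x] l by (simp add: abs_mult mult_left_le)
        then show ?thesis using k'b[of x n] by linarith
      qed
      show "(\<lambda>n. f 1 x * k' n x - l\<^sub>p * k n x) \<longlonglongrightarrow> (- l\<^sub>p) * indicator {p\<^sub>p} x" for x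
        using tendsto_diff[OF tendsto_mult[OF tendsto_const[of "f 1 x"] k'lim[of x]]
            tendsto_mult[OF tendsto_const[of "l\<^sub>p"] klim[of x]]]
        by simp
    qed
    show "(\<lambda>n. \<integral>x. l\<^sub>m * k n x \<partial>m (-1)) \<longlonglongrightarrow> l\<^sub>m * measure (m (-1)) {p\<^sub>p}"
    proof (rule integral_tendsto_point[OF fin sets])
      show "(\<lambda>x. l\<^sub>m * k n x) \<in> borel_measurable borel" for n using mk by measurable
      show "\<bar>l\<^sub>m * k n x\<bar> \<le> l\<^sub>m" for n x using k01[of n x] l by (simp add: abs_mult mult_left_le)
      show "(\<lambda>n. l\<^sub>m * k n x) \<longlonglongrightarrow> l\<^sub>m * indicator {p\<^sub>p} x" for x
        by (intro tendsto_intros klim)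
    qed
  qed
  then have "(- l\<^sub>p) * measure (m 1) {p\<^sub>p} + l\<^sub>m * measure (m (-1)) {p\<^sub>p} = 0"
    using gen by (simp add: LIMSEQ_const_iff)
  then have "measure (m 1) {p\<^sub>p} = 0" using m2 l by simp
  then show ?thesis using assms m2 by (auto simp: env_states_def)
qed

lemma AE_interval:
  assumes "i \<in> env_states" shows "AE x in m i. 0 < x \<and> x < p\<^sub>p"
proof -
  have "AE x in m i. x \<noteq> p\<^sub>p"
    using no_atom[OF assms] by (intro AE_I[of _ _ "{p\<^sub>p}"]) (auto simp: M.emeasure_eq_measure sets)
  with pos AE_le_carrying_capacity[OF assms] show ?thesis
    by eventually_elim simp
qed

end

section \<open>The integrating factor and the candidate density\<close>

context logistic_switching
begin

text \<open>The integrating factor exp W. Partial fractions split each quotient of rate by field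
  into multiples of 1/x and of the pole at the nonzero rest point; the logarithms are then
  collected.\<close>

definition weight :: "real \<Rightarrow> real" where
  "weight x = exp ((l\<^sub>p / p\<^sub>p + l\<^sub>m / p\<^sub>m) * ln x - l\<^sub>m / p\<^sub>m * ln (x - p\<^sub>m) - l\<^sub>p / p\<^sub>p * ln (p\<^sub>p - x))"

text \<open>The density up to its constant, chosen so that the flux has modulus
  \<open>1 / weight x\<close> in both environments; the absolute value absorbs the opposite signs of
  the two fields.\<close>

definition profile :: "int \<Rightarrow> real \<Rightarrow> real" where
  "profile i x = (if 0 < x \<and> x < p\<^sub>p then 1 / (weight x * \<bar>f i x\<bar>) else 0)"

lemma field_pos: "0 < x \<Longrightarrow> x < p\<^sub>p \<Longrightarrow> 0 < f 1 x"
  and field_neg: "0 < x \<Longrightarrow> f (-1) x < 0"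
  using p by auto

lemma weight_pos: "0 < weight x" by (simp add: weight_def)

lemma weight_deriv:
  assumes "0 < x" "x < p\<^sub>p"
  shows "(weight has_real_derivative weight x * (l\<^sub>p / f 1 x + l\<^sub>m / f (-1) x)) (at x)"
proof -
  have "x - p\<^sub>m > 0" "p\<^sub>p - x > 0" using assms p by auto
  have "(l\<^sub>p / p\<^sub>p + l\<^sub>m / p\<^sub>m) / x - l\<^sub>m / p\<^sub>m / (x - p\<^sub>m) + l\<^sub>p / p\<^sub>p / (p\<^sub>p - x)
      = l\<^sub>p / f 1 x + l\<^sub>m / f (-1) x"
  proof -
    have "l\<^sub>p / p\<^sub>p / x + l\<^sub>p / p\<^sub>p / (p\<^sub>p - x) = l\<^sub>p / f 1 x"
      using assms p by (simp add: field_simps)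
    moreover have "l\<^sub>m / p\<^sub>m / x - l\<^sub>m / p\<^sub>m / (x - p\<^sub>m) = l\<^sub>m / f (-1) x"
      using assms p by (simp add: divide_simps) (simp add: algebra_simps)
    ultimately show ?thesis by (simp add: add_divide_distrib)
  qed
  moreover have "((\<lambda>x. (l\<^sub>p / p\<^sub>p + l\<^sub>m / p\<^sub>m) * ln x - l\<^sub>m / p\<^sub>m * ln (x - p\<^sub>m) - l\<^sub>p / p\<^sub>p * ln (p\<^sub>p - x))
      has_real_derivative (l\<^sub>p / p\<^sub>p + l\<^sub>m / p\<^sub>m) * (1 / x) - l\<^sub>m / p\<^sub>m * (1 / (x - p\<^sub>m) * 1)
        - l\<^sub>p / p\<^sub>p * (1 / (p\<^sub>p - x) * - 1)) (at x)"
  proof (intro DERIV_diff DERIV_cmult)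
    show "(ln has_real_derivative 1 / x) (at x)" by (rule DERIV_ln_divide) fact
    show "((\<lambda>x. ln (x - p\<^sub>m)) has_real_derivative 1 / (x - p\<^sub>m) * 1) (at x)"
      by (rule DERIV_chain2[OF DERIV_ln_divide]) (fact, auto intro!: derivative_eq_intros)
    show "((\<lambda>x. ln (p\<^sub>p - x)) has_real_derivative 1 / (p\<^sub>p - x) * - 1) (at x)"
      by (rule DERIV_chain2[OF DERIV_ln_divide]) (fact, auto intro!: derivative_eq_intros)
  qed
  from DERIV_chain2[OF DERIV_exp this] have "(weight has_real_derivative weight x *
      ((l\<^sub>p / p\<^sub>p + l\<^sub>m / p\<^sub>m) / x - l\<^sub>m / p\<^sub>m / (x - p\<^sub>m) + l\<^sub>p / p\<^sub>p / (p\<^sub>p - x))) (at x)"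
    by (simp add: weight_def[abs_def])
  ultimately show ?thesis by simp
qed

lemma continuous_weight: "continuous_on {0<..<p\<^sub>p} weight"
proof (rule continuous_at_imp_continuous_on, rule ballI)
  fix x assume "x \<in> {0<..<p\<^sub>p}"
  then show "isCont weight x" by (intro DERIV_isCont[OF weight_deriv]) auto
qed

lemma continuous_profile:
  assumes i: "i \<in> env_states"
  shows "continuous_on {0<..<p\<^sub>p} (profile i)"
proof -
  have "weight x * \<bar>f i x\<bar> \<noteq> 0" if "x \<in> {0<..<p\<^sub>p}" for x
    using weight_pos[of x] field_pos[of x] field_neg[of x] that i
    by (auto simp: env_states_def simp del: field_1 field_m1)
  then have "continuous_on {0<..<p\<^sub>p} (\<lambda>x. 1 / (weight x * \<bar>f i x\<bar>))"
    by (intro continuous_on_divide continuous_on_mult continuous_on_rabs continuous_on_const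
        continuous_weight continuous_field) blast
  then show ?thesis by (rule continuous_on_eq) (simp add: profile_def)
qed

lemma profile_nonneg: "0 \<le> profile i x"
  using weight_pos[of x] by (simp add: profile_def)

end

section \<open>Identification of the two densities\<close>

context stationary_pair
begin

text \<open>Mean zero gives \<open>u\<close> a compactly supported antiderivative \<open>k\<close>,
  so \<open>k\<close> times the weight stays away from the ends, where the weight may be
  singular.\<close>

lemma weighted_flux_orthogonal:
  assumes u: "compactly_supported u a b" and ab: "0 < a" "a \<le> b" "b < p\<^sub>p" and u0: "integral {a..b} u = 0"
  shows "(\<integral>x. u x * (f 1 x * weight x) \<partial>m 1) = 0"
proof -
  let ?S = "{0<..<p\<^sub>p}"
  have S: "open ?S" "{a..b} \<subseteq> ?S" using ab by auto
  obtain k where k: "\<And>x. (k has_real_derivative u x) (at x)"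
    "\<And>x. x \<le> a \<Longrightarrow> k x = 0" "\<And>x. b \<le> x \<Longrightarrow> k x = 0"
    using compactly_supported_antiderivative[OF u ab(2)] u0 by metis
  have kc: "compactly_supported k a b"
    unfolding compactly_supported_def using k
    by (auto intro!: continuous_at_imp_continuous_on DERIV_isCont)
  define w where "w x = l\<^sub>p / f 1 x + l\<^sub>m / f (-1) x" for x
  define g where "g x = k x * weight x" for x
  define g' where "g' x = u x * weight x + k x * (weight x * w x)" for x
  have cw: "continuous_on ?S w" unfolding w_def
    by (intro continuous_intros continuous_field) (use field_pos field_neg in force)+
  have gc: "compactly_supported g a b" unfolding g_def
    by (rule compactly_supported_mult[OF kc continuous_weight S])
  have g'c: "compactly_supported g' a b" unfolding g'_def
    by (intro compactly_supported_add compactly_supported_mult[OF u _ S] compactly_supported_mult[OF kc _ S]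
        continuous_intros continuous_weight cw)
  have dg: "(g has_real_derivative g' x) (at x)" for x
  proof (cases "x \<in> {a..b}")
    case True
    then have x: "0 < x" "x < p\<^sub>p" using ab by auto
    show ?thesis unfolding g_def[abs_def] g'_def
      using DERIV_mult[OF k(1)[of x] weight_deriv[OF x]] by (simp add: w_def algebra_simps)
  next
    case False
    have "g' x = 0" using g'c False by (simp add: compactly_supported_def)
    moreover have "(g has_real_derivative 0) (at x)"
      by (rule has_field_derivative_transform_within_open[OF DERIV_const[of 0], where S = "- {a..b}"])
        (use False gc in \<open>auto simp: compactly_supported_def\<close>)
    ultimately show ?thesis by simp
  qed
  \<comment> \<open>The slope of the second component solves
    \<open>f (-1) x * v x + l\<^sub>m * g x = 0\<close>, so the generator vanishes identically in
    environment -1. Its antiderivative \<open>h\<close> is bounded without having compact support in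
    general.\<close>
  define v where "v x = g x * (- l\<^sub>m / f (-1) x)" for x
  have vc: "compactly_supported v a b" unfolding v_def
    by (rule compactly_supported_mult[OF gc _ S])
      (intro continuous_intros continuous_field, use field_neg in force)
  obtain h where h: "\<And>x. (h has_real_derivative v x) (at x)" "\<exists>B. \<forall>x. \<bar>h x\<bar> \<le> B"
    using compactly_supported_antiderivative[OF vc ab(2)] by metis
  have gb: "\<exists>B. \<forall>x. \<bar>h x + g x\<bar> \<le> B"
  proof -
    obtain B1 B2 where "\<And>x. \<bar>h x\<bar> \<le> B1" "\<And>x. \<bar>g x\<bar> \<le> B2"
      using h(2) compactly_supported_bounded[OF gc] by blast
    then have "\<bar>h x + g x\<bar> \<le> B1 + B2" for x by (meson abs_triangle_ineq add_mono order_trans)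
    then show ?thesis by blast
  qed
  let ?G = "\<lambda>j. if j = (1::int) then (\<lambda>x. h x + g x) else h" and ?G' = "\<lambda>j. if j = (1::int) then (\<lambda>x. v x + g' x) else v"
  have "test_function ?G ?G'"
    by (rule test_functionI[OF DERIV_add[OF h(1) dg] compactly_supported_add[OF vc g'c] gb h(1) vc h(2)])
  from stationary[OF this]
  have "(\<integral>x. generator ?G ?G' 1 x \<partial>m 1) + (\<integral>x. generator ?G ?G' (-1) x \<partial>m (-1)) = 0" .
  moreover have "generator ?G ?G' (-1) x = 0" for x
  proof (cases "x \<in> {a..b}")
    case True
    then have "f (-1) x \<noteq> 0" using ab field_neg[of x] by fastforce
    then show ?thesis by (simp add: generator_def v_def del: field_m1)
  next
    case False
    then have "v x = 0" "g x = 0" using vc gc by (auto simp: compactly_supported_def)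
    then show ?thesis by (simp add: generator_def)
  qed
  moreover have "generator ?G ?G' 1 x = u x * (f 1 x * weight x)" for x
  proof (cases "x \<in> {a..b}")
    case True
    then have x: "0 < x" "x < p\<^sub>p" using ab by auto
    have nz: "f 1 x \<noteq> 0" "f (-1) x \<noteq> 0" using field_pos[OF x] field_neg[OF x(1)] by linarith+
    have "generator ?G ?G' 1 x = f 1 x * (v x + g' x) - l\<^sub>p * g x"
      by (simp add: generator_def del: field_1 field_m1)
    \<comment> \<open>The terms without \<open>u\<close> add up to \<open>l\<^sub>p * g x\<close>,
      by the logarithmic derivative of the weight, and the switching term removes them.\<close>
    also have "\<dots> = u x * (f 1 x * weight x)"
      unfolding v_def g'_def g_def w_def using nz by (simp add: field_simps del: field_1 field_m1)
    finally show ?thesis .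
  next
    case False
    then have "v x = 0" "g x = 0" "g' x = 0" "u x = 0" using vc gc g'c u by (auto simp: compactly_supported_def)
    then show ?thesis by (simp add: generator_def)
  qed
  ultimately show ?thesis by simp
qed

text \<open>A functional that kills all functions of mean zero is a multiple of the integral:
  subtract from \<open>u\<close> its integral times a fixed \<open>\<psi>\<close> of integral 1. The
  constant is the value at \<open>\<psi>\<close>, nonnegative since \<open>\<psi>\<close>,
  \<open>f 1\<close> and the weight are nonnegative almost everywhere for
  \<open>m 1\<close>.\<close>

lemma weighted_flux_lebesgue:
  obtains C where "0 \<le> C" "\<And>u a b. compactly_supported u a b \<Longrightarrow> 0 < a \<Longrightarrow> a \<le> b \<Longrightarrow> b < p\<^sub>p \<Longrightarrow>
    (\<integral>x. u x * (f 1 x * weight x) \<partial>m 1) = C * (\<integral>x. u x \<partial>lborel)"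
proof -
  define \<psi>0 where "\<psi>0 x = max 0 (p\<^sub>p / 4 - \<bar>x - p\<^sub>p / 2\<bar>)" for x
  have \<psi>0: "compactly_supported \<psi>0 (p\<^sub>p / 4) (3 * p\<^sub>p / 4)"
    unfolding compactly_supported_def \<psi>0_def by (auto intro!: continuous_intros)
  define I where "I = (\<integral>x. \<psi>0 x \<partial>lborel)"
  have I: "I > 0"
  proof -
    have "I \<ge> 0" unfolding I_def \<psi>0_def by (intro integral_nonneg_AE) auto
    moreover have "I \<noteq> 0"
    proof
      assume "I = 0"
      then have "AE x in lborel. \<psi>0 x = 0"
        unfolding I_def by (subst (asm) integral_nonneg_eq_0_iff_AE)
          (use compactly_supported_lborel(1)[OF \<psi>0] in \<open>auto simp: \<psi>0_def\<close>)
      then have "AE x in lborel. (x \<in> {p\<^sub>p / 4<..<3 * p\<^sub>p / 4}) = (x \<in> {})"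
        by eventually_elim (auto simp: \<psi>0_def max_def abs_if split: if_splits)
      then have "emeasure lborel {p\<^sub>p / 4<..<3 * p\<^sub>p / 4} = emeasure lborel ({} :: real set)"
        by (rule emeasure_eq_AE) auto
      then show False using p by simp
    qed
    ultimately show ?thesis by simp
  qed
  define \<psi> where "\<psi> x = 1 / I * \<psi>0 x" for x
  have \<psi>: "compactly_supported \<psi> (p\<^sub>p / 4) (3 * p\<^sub>p / 4)"
    unfolding \<psi>_def by (rule compactly_supported_cmult[OF \<psi>0])
  have \<psi>1: "(\<integral>x. \<psi> x \<partial>lborel) = 1" unfolding \<psi>_def using I by (simp add: I_def[symmetric])
  define C where "C = (\<integral>x. \<psi> x * (f 1 x * weight x) \<partial>m 1)"
  have "0 \<le> C" unfolding C_def
  proof (rule integral_nonneg_AE, rule AE_mp[OF AE_interval AE_I2])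
    show "1 \<in> env_states" by (simp add: env_states_def)
    fix x show "0 < x \<and> x < p\<^sub>p \<longrightarrow> 0 \<le> \<psi> x * (f 1 x * weight x)"
      using field_pos[of x] weight_pos[of x] I
      by (auto simp: \<psi>_def \<psi>0_def less_imp_le simp del: field_1)
  qed
  moreover have "(\<integral>x. u x * (f 1 x * weight x) \<partial>m 1) = C * (\<integral>x. u x \<partial>lborel)"
    if u: "compactly_supported u a b" and ab: "0 < a" "a \<le> b" "b < p\<^sub>p" for u a b
  proof -
    define J where "J = (\<integral>x. u x \<partial>lborel)"
    \<comment> \<open>A common interval for the supports of \<open>u\<close> and
      \<open>\<psi>\<close>, still inside \<open>{0<..<p\<^sub>p}\<close>.\<close>
    define a' where "a' = min a (p\<^sub>p / 4)"
    define b' where "b' = max b (3 * p\<^sub>p / 4)"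
    have ab': "0 < a'" "a' \<le> b'" "b' < p\<^sub>p" using ab p by (auto simp: a'_def b'_def)
    have u': "compactly_supported u a' b'" by (rule compactly_supported_mono[OF u]) (auto simp: a'_def b'_def)
    have \<psi>': "compactly_supported (\<lambda>x. (- J) * \<psi> x) a' b'"
      by (rule compactly_supported_cmult, rule compactly_supported_mono[OF \<psi>]) (auto simp: a'_def b'_def)
    have s: "compactly_supported (\<lambda>x. u x + (- J) * \<psi> x) a' b'"
      by (rule compactly_supported_add[OF u' \<psi>'])
    have "integral {a'..b'} (\<lambda>x. u x + (- J) * \<psi> x) = (\<integral>x. u x + (- J) * \<psi> x \<partial>lborel)"
      by (rule compactly_supported_lborel(2)[OF s, symmetric])
    also have "\<dots> = 0"
      using compactly_supported_lborel(1)[OF u] compactly_supported_lborel(1)[OF \<psi>]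
      by (simp add: \<psi>1 J_def)
    finally have 0: "(\<integral>x. (u x + (- J) * \<psi> x) * (f 1 x * weight x) \<partial>m 1) = 0"
      by (rule weighted_flux_orthogonal[OF s ab'])
    have sub: "{a'..b'} \<subseteq> {0<..<p\<^sub>p}" using ab' by auto
    have int: "integrable (m 1) (\<lambda>x. v x * (f 1 x * weight x))" if "compactly_supported v a' b'" for v
      by (rule compactly_supported_integrable[OF compactly_supported_mult[OF that _ open_greaterThanLessThan sub] fin sets])
        (intro continuous_intros continuous_field continuous_weight)
    have "(\<integral>x. u x * (f 1 x * weight x) \<partial>m 1) + (\<integral>x. ((- J) * \<psi> x) * (f 1 x * weight x) \<partial>m 1) = 0"
      using Bochner_Integration.integral_add[OF int[OF u'] int[OF \<psi>']] 0 by (simp only: distrib_right)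
    moreover have "(\<integral>x. ((- J) * \<psi> x) * (f 1 x * weight x) \<partial>m 1) = - J * C"
      unfolding C_def by (simp only: mult.assoc integral_mult_right_zero)
    ultimately show ?thesis by (simp add: J_def)
  qed
  ultimately show ?thesis using that by blast
qed

text \<open>Inside the interval \<open>profile 1\<close> is the reciprocal of
  \<open>f 1 x * weight x\<close>, so testing with \<open>v x * profile 1 x\<close> recovers the
  integral of \<open>v\<close> against \<open>m 1\<close>. The other measure is reached through the
  flux balance.\<close>

lemma stationary_densities:
  obtains C where "0 \<le> C" "\<And>i. i \<in> env_states \<Longrightarrow> m i = density lborel (\<lambda>x. ennreal (C * profile i x))"
proof -
  obtain C where C: "0 \<le> C" "\<And>u a b. compactly_supported u a b \<Longrightarrow> 0 < a \<Longrightarrow> a \<le> b \<Longrightarrow> b < p\<^sub>p \<Longrightarrow>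
    (\<integral>x. u x * (f 1 x * weight x) \<partial>m 1) = C * (\<integral>x. u x \<partial>lborel)"
    using weighted_flux_lebesgue by metis
  have main: "(\<integral>x. v x \<partial>m i) = (\<integral>x. v x * (C * profile i x) \<partial>lborel)"
    if v: "compactly_supported v a b" and ab: "0 < a" "a \<le> b" "b < p\<^sub>p" and i: "i \<in> env_states" for v a b i
  proof -
    have S: "open {0<..<p\<^sub>p}" "{a..b} \<subseteq> {0<..<p\<^sub>p}" using ab by auto
    have 1: "(\<integral>x. v x \<partial>m 1) = C * (\<integral>x. v x * profile 1 x \<partial>lborel)" if v: "compactly_supported v a b" for v
    proof -
      have "compactly_supported (\<lambda>x. v x * profile 1 x) a b"
        by (rule compactly_supported_mult[OF v continuous_profile S]) (simp add: env_states_def)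
      from C(2)[OF this ab] have "(\<integral>x. v x * profile 1 x * (f 1 x * weight x) \<partial>m 1) = C * (\<integral>x. v x * profile 1 x \<partial>lborel)" .
      moreover have "v x * profile 1 x * (f 1 x * weight x) = v x" for x
      proof (cases "x \<in> {a..b}")
        case True
        then have x: "0 < x" "x < p\<^sub>p" using ab by auto
        then show ?thesis using field_pos[OF x] weight_pos[of x] by (simp add: profile_def del: field_1)
      qed (use v in \<open>simp add: compactly_supported_def\<close>)
      ultimately show ?thesis by (simp only:)
    qed
    have 2: "(\<integral>x. v x \<partial>m (-1)) = C * (\<integral>x. v x * profile (-1) x \<partial>lborel)"
    proof -
      \<comment> \<open>Division by \<open>f (-1)\<close> makes the integral of \<open>v\<close>
        against \<open>m (-1)\<close> one side of the flux balance; the other side is an integral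
        against \<open>m 1\<close>.\<close>
      let ?u = "\<lambda>x. v x * (1 / f (-1) x)"
      have u: "compactly_supported ?u a b"
        by (rule compactly_supported_mult[OF v _ S])
          (intro continuous_intros continuous_field, use field_neg in force)
      have uf: "compactly_supported (\<lambda>x. ?u x * f 1 x) a b"
        by (rule compactly_supported_mult[OF u continuous_field S])
      have "?u x * f (-1) x = v x" for x
      proof (cases "x \<in> {a..b}")
        case True
        then show ?thesis using field_neg[of x] ab by (simp del: field_m1)
      qed (use v in \<open>simp add: compactly_supported_def\<close>)
      then have "(\<integral>x. v x \<partial>m (-1)) = - (\<integral>x. ?u x * f 1 x \<partial>m 1)"
        using flux_balance[OF u] by (simp del: field_1 field_m1)
      also have "\<dots> = - (C * (\<integral>x. ?u x * f 1 x * profile 1 x \<partial>lborel))"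
        by (simp only: 1[OF uf])
      also have "\<dots> = C * (\<integral>x. - (?u x * f 1 x * profile 1 x) \<partial>lborel)" by simp
      also have "(\<lambda>x. - (?u x * f 1 x * profile 1 x)) = (\<lambda>x. v x * profile (-1) x)"
      proof
        fix x
        show "- (?u x * f 1 x * profile 1 x) = v x * profile (-1) x"
        proof (cases "x \<in> {a..b}")
          case True
          then have x: "0 < x" "x < p\<^sub>p" using ab by auto
          then show ?thesis using field_pos[OF x] field_neg[OF x(1)] weight_pos[of x]
            by (simp add: profile_def field_simps del: field_1 field_m1)
        qed (use v in \<open>simp add: compactly_supported_def\<close>)
      qed
      finally show ?thesis .
    qed
    have "(\<integral>x. v x \<partial>m i) = C * (\<integral>x. v x * profile i x \<partial>lborel)"
      using 1[OF v] 2 i by (auto simp: env_states_def)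
    then show ?thesis by (simp add: mult.left_commute)
  qed
  have "m i = density lborel (\<lambda>x. ennreal (C * profile i x))" if i: "i \<in> env_states" for i
  proof (rule density_eqI_compactly_supported[OF fin sets p(2) AE_interval[OF i]])
    show "continuous_on {0<..<p\<^sub>p} (\<lambda>x. C * profile i x)"
      by (intro continuous_intros continuous_profile i)
    show "0 \<le> C * profile i x" for x using C(1) profile_nonneg by simp
    show "C * profile i x = 0" if "x \<notin> {0<..<p\<^sub>p}" for x using that by (auto simp: profile_def)
  qed (use main i in blast)
  with C(1) show ?thesis using that by blast
qed

end

section \<open>The invariant density\<close>

lemma sets_reference_measure: "sets reference_measure = sets state_space"
  unfolding reference_measure_def state_space_def
  by (intro sets_pair_measure_cong sets_restrict_space_cong) auto

context logistic_switching
begin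

text \<open>For the two states the numbers 1/2 (1 - i) and 1/2 (1 + i) are 0 or 1. They select the
  second factor of the field: x - \<open>p\<^sub>m\<close> for i = -1 and \<open>p\<^sub>p\<close> -
  x for i = 1. The common factor x accounts for the -1 in the first exponent.\<close>

lemma profile_powr:
  assumes i: "i \<in> env_states"
  shows "profile i x = x powr (- l\<^sub>m / p\<^sub>m - l\<^sub>p / p\<^sub>p - 1)
    * (- p\<^sub>m + x) powr (l\<^sub>m / p\<^sub>m - 1 / 2 * (1 - real_of_int i))
    * (p\<^sub>p - x) powr (l\<^sub>p / p\<^sub>p - 1 / 2 * (1 + real_of_int i)) * indicator {0<..<p\<^sub>p} x"
proof (cases "0 < x \<and> x < p\<^sub>p")
  case True
  then have x: "0 < x" "0 < x - p\<^sub>m" "0 < p\<^sub>p - x" using p by auto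
  have w: "weight x = x powr (l\<^sub>p / p\<^sub>p + l\<^sub>m / p\<^sub>m) / (x - p\<^sub>m) powr (l\<^sub>m / p\<^sub>m) / (p\<^sub>p - x) powr (l\<^sub>p / p\<^sub>p)"
    using x by (simp add: weight_def powr_def exp_diff)
  have e: "- l\<^sub>m / p\<^sub>m - l\<^sub>p / p\<^sub>p - 1 = - (l\<^sub>p / p\<^sub>p + l\<^sub>m / p\<^sub>m) - 1" by simp
  have "x powr (- l\<^sub>m / p\<^sub>m - l\<^sub>p / p\<^sub>p - 1) = 1 / (x powr (l\<^sub>p / p\<^sub>p + l\<^sub>m / p\<^sub>m) * x)"
    unfolding e powr_diff powr_minus using x by (simp add: field_simps)
  moreover have "- p\<^sub>m + x = x - p\<^sub>m" by simp
  ultimately show ?thesis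
    using True x i field_pos[of x] field_neg[of x]
    by (auto simp: profile_def env_states_def w powr_diff abs_mult)
qed (auto simp: profile_def)

lemma borel_measurable_profile:
  assumes "i \<in> env_states"
  shows "profile i \<in> borel_measurable borel"
proof -
  have "(\<lambda>x. if x \<in> {0<..<p\<^sub>p} then profile i x else 0) \<in> borel_measurable borel"
    by (rule borel_measurable_continuous_on_if) (use continuous_profile[OF assms] in auto)
  moreover have "(\<lambda>x. if x \<in> {0<..<p\<^sub>p} then profile i x else 0) = profile i"
    by (auto simp: profile_def)
  ultimately show ?thesis by simp
qed

lemma borel_measurable_profile_density:
  "(\<lambda>(x, i). ennreal (C * profile i x)) \<in> borel_measurable reference_measure"
proof -
  have "(\<lambda>z. C * profile (snd z) (fst z)) \<in> borel_measurable state_space"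
    using measurable_state_space[of "\<lambda>i x. C * profile i x"] borel_measurable_profile by simp
  then show ?thesis
    by (simp add: case_prod_beta' cong: measurable_cong_sets[OF sets_reference_measure refl])
qed

lemma measurable_fst_state_space: "fst \<in> borel_measurable state_space"
  unfolding state_space_def
  by (rule measurable_compose[OF measurable_fst measurable_restrict_space1]) simp

section \<open>Splitting the invariant measure into its two layers\<close>

lemma generator_bounded:
  assumes "test_function g g'"
  shows "\<exists>B. \<forall>i. \<forall>x\<ge>0. \<bar>generator g g' i x\<bar> \<le> B"
proof -
  obtain G where G: "\<And>j x. \<bar>g j x\<bar> \<le> G" using assms by (auto simp: test_function_def)
  obtain C where C: "\<And>i j x. x \<ge> 0 \<Longrightarrow> \<bar>f i x * g' j x\<bar> \<le> C"
    using assms by (auto simp: test_function_def)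
  have "\<bar>generator g g' i x\<bar> \<le> C + (l\<^sub>m + l\<^sub>p) * (2 * G)" if "x \<ge> 0" for i x
  proof -
    have "\<bar>r i * (g (- i) x - g i x)\<bar> \<le> (l\<^sub>m + l\<^sub>p) * (2 * G)"
      unfolding abs_mult using G[of "- i" x] G[of i x] l
      by (intro mult_mono) (auto simp: switch_rate_def)
    then show ?thesis using C[OF that, of i i] unfolding generator_def by linarith
  qed
  then show ?thesis by blast
qed

lemma measurable_generator: "test_function g g' \<Longrightarrow> generator g g' i \<in> borel_measurable borel"
proof -
  assume t: "test_function g g'"
  have [measurable]: "g j \<in> borel_measurable borel" for j
    using t by (intro borel_measurable_continuous_onI continuous_at_imp_continuous_on)
      (auto simp: test_function_def intro: DERIV_isCont)
  have [measurable]: "g' j \<in> borel_measurable borel" for j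
    using t by (intro borel_measurable_continuous_onI) (auto simp: test_function_def)
  have [measurable]: "f i \<in> borel_measurable borel"
    by (intro borel_measurable_continuous_onI continuous_field)
  show ?thesis unfolding generator_def[abs_def] by measurable
qed

text \<open>The layers of \<open>\<mu>\<close> over the two states, pushed to the line, form a
  stationary pair; their densities are then reassembled on the product space. The constant cannot
  vanish because \<open>\<mu>\<close> has total mass 1.\<close>

lemma invariant_density:
  assumes inv: "invariant_prob f r \<mu>" and mass: "emeasure \<mu> ({0<..} \<times> env_states) = 1"
  obtains C where "0 < C" "\<mu> = density reference_measure (\<lambda>(x, i). ennreal (C * profile i x))"
proof -
  interpret prob_space \<mu> using inv by (simp add: invariant_prob_def)
  have s: "sets \<mu> = sets state_space" using inv by (simp add: invariant_prob_def)
  note [measurable_cong] = s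
  have sp: "space \<mu> = {0..} \<times> env_states"
    using sets_eq_imp_space_eq[OF s] by (simp add: space_state_space)
  have fst_m [measurable]: "fst \<in> borel_measurable \<mu>"
    using measurable_fst_state_space by (simp cong: measurable_cong_sets[OF s refl])
  have "(\<lambda>z. indicator {j} (snd z) :: real) \<in> borel_measurable state_space" for j :: int
    using measurable_state_space[of "\<lambda>i x. indicator {j} i"] by simp
  then have ind_m [measurable]: "(\<lambda>z. indicator {j} (snd z) :: real) \<in> borel_measurable \<mu>" for j :: int
    by (simp only: measurable_cong_sets[OF s refl])
  \<comment> \<open>The layer over \<open>j\<close>, cut out by a density and projected to the line.
    For a \<open>j\<close> that is no state this is the zero measure, so the locale assumptions hold
    at every integer.\<close>
  define m where "m j = distr (density \<mu> (\<lambda>z. ennreal (indicator {j} (snd z)))) borel fst" for j :: int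
  have m_int: "(\<integral>x. h x \<partial>m j) = (\<integral>z. indicator {j} (snd z) * h (fst z) \<partial>\<mu>)"
    if [measurable]: "h \<in> borel_measurable borel" for h :: "real \<Rightarrow> real" and j
    unfolding m_def by (subst integral_distr, simp_all, subst integral_density) auto
  have m_nn: "(\<integral>\<^sup>+x. h x \<partial>m j) = (\<integral>\<^sup>+z. indicator {j} (snd z) * h (fst z) \<partial>\<mu>)"
    if [measurable]: "h \<in> borel_measurable borel" for h :: "real \<Rightarrow> ennreal" and j
    unfolding m_def by (subst nn_integral_distr, simp_all, subst nn_integral_density)
      (measurable, simp add: ennreal_indicator)
  have AE_pos: "AE z in \<mu>. z \<in> {0<..} \<times> env_states"
  proof -
    have "{0<..} \<in> sets (restrict_space borel {0::real..})"
      by (subst sets_restrict_space_iff) auto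
    then have "{0<..} \<times> env_states \<in> sets \<mu>"
      unfolding s state_space_def by (intro pair_measureI) auto
    then show ?thesis using mass by (subst AE_in_set_eq_1) (auto simp: emeasure_eq_measure)
  qed
  interpret stationary_pair p\<^sub>m p\<^sub>p l\<^sub>m l\<^sub>p m
  proof (rule stationary_pair.intro[OF logistic_switching_axioms stationary_pair_axioms.intro])
    fix j :: int
    show "sets (m j) = sets borel" by (simp add: m_def)
    have "emeasure (m j) (space (m j)) = (\<integral>\<^sup>+z. indicator {j} (snd z) * 1 \<partial>\<mu>)"
      using m_nn[of "\<lambda>_. 1" j] by simp
    also have "\<dots> \<le> (\<integral>\<^sup>+z. 1 \<partial>\<mu>)"
      by (intro nn_integral_mono) (auto simp: indicator_def)
    also have "\<dots> < \<infinity>" by (simp add: emeasure_space_1)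
    finally show "finite_measure (m j)" by (intro finite_measureI) simp
    show "AE x in m j. 0 < x"
      unfolding m_def using AE_pos by (subst AE_distr_iff, simp_all, subst AE_density) (auto elim!: eventually_mono)
  next
    fix g g' assume t: "test_function g g'"
    obtain B where B: "\<And>i x. x \<ge> 0 \<Longrightarrow> \<bar>generator g g' i x\<bar> \<le> B"
      using generator_bounded[OF t] by blast
    note gm [measurable] = measurable_generator[OF t]
    have B0: "0 \<le> B" using B[of 0 0] by linarith
    have int: "integrable \<mu> (\<lambda>z. indicator {j} (snd z) * generator g g' j (fst z))" for j :: int
    proof (rule integrable_const_bound[of _ B])
      show "AE z in \<mu>. norm (indicator {j} (snd z) * generator g g' j (fst z)) \<le> B"
        using B B0 by (intro AE_I2) (auto simp: sp indicator_def)
    qed measurable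
    have "(\<integral>x. generator g g' 1 x \<partial>m 1) + (\<integral>x. generator g g' (-1) x \<partial>m (-1)) =
      (\<integral>z. indicator {1} (snd z) * generator g g' 1 (fst z)
        + indicator {-1} (snd z) * generator g g' (-1) (fst z) \<partial>\<mu>)"
      unfolding m_int[OF gm] by (rule Bochner_Integration.integral_add[OF int int, symmetric])
    also have "\<dots> = (\<integral>z. generator g g' (snd z) (fst z) \<partial>\<mu>)"
      by (rule Bochner_Integration.integral_cong) (auto simp: sp env_states_def)
    also have "\<dots> = 0" by (rule generator_mean_zero[OF inv t])
    finally show "(\<integral>x. generator g g' 1 x \<partial>m 1) + (\<integral>x. generator g g' (-1) x \<partial>m (-1)) = 0" .
  qed
  obtain C where C: "0 \<le> C" "\<And>i. i \<in> env_states \<Longrightarrow> m i = density lborel (\<lambda>x. ennreal (C * profile i x))"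
    using stationary_densities by metis
  let ?\<rho> = "\<lambda>(x, i). ennreal (C * profile i x)"
  note pm = borel_measurable_profile and sr = sets_reference_measure and \<rho>m = borel_measurable_profile_density[of C]
  have eq: "\<mu> = density reference_measure ?\<rho>"
  proof (rule measure_eqI)
    show "sets \<mu> = sets (density reference_measure ?\<rho>)" by (simp add: s sr)
    fix A assume "A \<in> sets \<mu>"
    then have A: "A \<in> sets state_space" by (simp add: s)
    have A_sub: "A \<subseteq> {0..} \<times> env_states" using sets.sets_into_space[OF A] by (simp add: space_state_space)
    \<comment> \<open>Sections of \<open>A\<close> are measurable in the restricted space; as
      \<open>{0..}\<close> is Borel, they are Borel sets of the line as well.\<close>
    have slice: "(\<lambda>x. indicator A (x, j) :: ennreal) \<in> borel_measurable borel" if j: "j \<in> env_states" for j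
    proof -
      have "(\<lambda>x. (x, j)) -` A \<in> sets (restrict_space borel {0::real..})"
        by (rule sets_Pair2[OF A[unfolded state_space_def]])
      moreover have "(\<lambda>x. (x, j)) -` A = {x. (x, j) \<in> A}" by auto
      moreover have "{x. (x, j) \<in> A} \<in> sets borel \<longleftrightarrow> {x. (x, j) \<in> A} \<in> sets (restrict_space borel {0::real..})"
        using A_sub by (subst sets_restrict_space_iff) auto
      ultimately have "(indicator {x. (x, j) \<in> A} :: real \<Rightarrow> ennreal) \<in> borel_measurable borel" by simp
      then show ?thesis by (simp add: indicator_def[abs_def])
    qed
    have e: "1 \<in> env_states" "-1 \<in> env_states" by (auto simp: env_states_def)
    have part: "(\<integral>\<^sup>+z. indicator {j} (snd z) * indicator A (fst z, j) \<partial>\<mu>)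
        = (\<integral>\<^sup>+x. ennreal (C * profile j x) * indicator A (x, j) \<partial>lborel)" if j: "j \<in> env_states" for j
      unfolding m_nn[OF slice[OF j], symmetric] C(2)[OF j]
      by (rule nn_integral_density) (use pm[OF j] slice[OF j] in auto)
    have "emeasure \<mu> A = (\<integral>\<^sup>+z. indicator A z \<partial>\<mu>)" using A s by simp
    also have "\<dots> = (\<integral>\<^sup>+z. indicator {1} (snd z) * indicator A (fst z, 1)
        + indicator {-1} (snd z) * indicator A (fst z, -1) \<partial>\<mu>)"
      by (rule nn_integral_cong) (auto simp: sp env_states_def indicator_def)
    also have "\<dots> = (\<integral>\<^sup>+z. indicator {1} (snd z) * indicator A (fst z, 1) \<partial>\<mu>)
        + (\<integral>\<^sup>+z. indicator {-1} (snd z) * indicator A (fst z, -1) \<partial>\<mu>)"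
    proof (rule nn_integral_add)
      have "(\<lambda>z. indicator {j} (snd z) * indicator A (fst z, j) :: ennreal) \<in> borel_measurable \<mu>"
        if j: "j \<in> env_states" for j
      proof -
        have "(\<lambda>z. ennreal (indicator {j} (snd z)) * indicator A (fst z, j)) \<in> borel_measurable \<mu>"
          using measurable_compose[OF fst_m slice[OF j]] by measurable
        then show ?thesis by (simp add: ennreal_indicator)
      qed
      then show "(\<lambda>z. indicator {1} (snd z) * indicator A (fst z, 1) :: ennreal) \<in> borel_measurable \<mu>"
        "(\<lambda>z. indicator {-1} (snd z) * indicator A (fst z, -1) :: ennreal) \<in> borel_measurable \<mu>"
        using e by auto
    qed
    also have "\<dots> = (\<integral>\<^sup>+x. ennreal (C * profile 1 x) * indicator A (x, 1) \<partial>lborel)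
        + (\<integral>\<^sup>+x. ennreal (C * profile (-1) x) * indicator A (x, -1) \<partial>lborel)"
      by (simp only: part[OF e(1)] part[OF e(2)])
    also have "\<dots> = (\<integral>\<^sup>+x. ennreal (C * profile 1 x) * indicator A (x, 1)
        + ennreal (C * profile (-1) x) * indicator A (x, -1) \<partial>lborel)"
      by (rule nn_integral_add[symmetric]) (use pm[OF e(1)] pm[OF e(2)] slice[OF e(1)] slice[OF e(2)] in auto)
    \<comment> \<open>The indicator of \<open>{0..}\<close> changes nothing since \<open>A\<close>
      lies in the state space; with it, the sum over states and the integral over the line become an
      iterated integral for the reference measure.\<close>
    also have "\<dots> = (\<integral>\<^sup>+x. (\<integral>\<^sup>+i. ?\<rho> (x, i) * indicator A (x, i) \<partial>count_space env_states) * indicator {0..} x \<partial>lborel)"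
      by (rule nn_integral_cong)
        (use A_sub in \<open>auto simp: nn_integral_count_space_finite env_states_def indicator_def\<close>)
    also have "\<dots> = (\<integral>\<^sup>+x. (\<integral>\<^sup>+i. ?\<rho> (x, i) * indicator A (x, i) \<partial>count_space env_states) \<partial>restrict_space lborel {0..})"
      by (subst nn_integral_restrict_space) auto
    also have "\<dots> = (\<integral>\<^sup>+z. ?\<rho> z * indicator A z \<partial>reference_measure)"
    proof -
      interpret c: sigma_finite_measure "count_space env_states"
        by (rule sigma_finite_measure_count_space_finite) (simp add: env_states_def)
      have "(\<lambda>z. ?\<rho> z * indicator A z) \<in> borel_measurable reference_measure"
        using A by (intro borel_measurable_times_ennreal \<rho>m borel_measurable_indicator) (simp add: sr)
      then show ?thesis unfolding reference_measure_def by (rule c.nn_integral_fst)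
    qed
    also have "\<dots> = emeasure (density reference_measure ?\<rho>) A"
      using A by (intro emeasure_density[symmetric] \<rho>m) (simp add: sr)
    finally show "emeasure \<mu> A = emeasure (density reference_measure ?\<rho>) A" .
  qed
  have "C \<noteq> 0"
  proof
    assume "C = 0"
    then have "emeasure \<mu> (space \<mu>) = emeasure (density reference_measure (\<lambda>_. 0)) (space \<mu>)"
      using eq by (simp add: case_prod_beta')
    also have "\<dots> = 0" by (subst emeasure_density) (auto simp: sr s[symmetric])
    finally show False using emeasure_space_1 by simp
  qed
  with C(1) eq show ?thesis using that[of C] by simp
qed

end

theorem theorem3p5:
  fixes p\<^sub>m p\<^sub>p l\<^sub>m l\<^sub>p :: real and \<mu> :: "(real \<times> int) measure"
  assumes "p\<^sub>m < 0" and "0 < p\<^sub>p" and "0 < l\<^sub>m" and "0 < l\<^sub>p"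
    and "l\<^sub>p / p\<^sub>p < - (l\<^sub>m / p\<^sub>m)"
    and "ergodic_invariant_prob (logistic_field p\<^sub>m p\<^sub>p) (switch_rate l\<^sub>m l\<^sub>p) \<mu>"
    and "emeasure \<mu> ({0<..} \<times> env_states) = 1"
  shows "absolutely_continuous reference_measure \<mu> \<and>
    (\<exists>C>0. \<mu> = density reference_measure (\<lambda>(x, i). ennreal
       (C * x powr (- l\<^sub>m / p\<^sub>m - l\<^sub>p / p\<^sub>p - 1)
          * (- p\<^sub>m + x) powr (l\<^sub>m / p\<^sub>m - 1 / 2 * (1 - real_of_int i))
          * (p\<^sub>p - x) powr (l\<^sub>p / p\<^sub>p - 1 / 2 * (1 + real_of_int i))
          * indicator {0<..<p\<^sub>p} x)))"
proof -
  interpret logistic_switching p\<^sub>m p\<^sub>p l\<^sub>m l\<^sub>p by unfold_locales fact+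
  have "invariant_prob f r \<mu>" using assms by (simp add: ergodic_invariant_prob_def)
  then obtain C where C: "0 < C" "\<mu> = density reference_measure (\<lambda>(x, i). ennreal (C * profile i x))"
    using invariant_density assms(7) by metis
  let ?\<rho> = "\<lambda>(x, i). ennreal
       (C * x powr (- l\<^sub>m / p\<^sub>m - l\<^sub>p / p\<^sub>p - 1)
          * (- p\<^sub>m + x) powr (l\<^sub>m / p\<^sub>m - 1 / 2 * (1 - real_of_int i))
          * (p\<^sub>p - x) powr (l\<^sub>p / p\<^sub>p - 1 / 2 * (1 + real_of_int i))
          * indicator {0<..<p\<^sub>p} x)"
  have sp: "space reference_measure = {0..} \<times> env_states"
    by (simp add: reference_measure_def space_pair_measure space_restrict_space)
  note \<rho>' = borel_measurable_profile_density[of C]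
  \<comment> \<open>The power form was shown for labels in \<open>env_states\<close>, hence the
    comparison on the space of the reference measure.\<close>
  have eq: "(case z of (x, i) \<Rightarrow> ennreal (C * profile i x)) = ?\<rho> z" if "z \<in> space reference_measure" for z
    using that by (auto simp: sp profile_powr mult.assoc)
  have \<rho>: "?\<rho> \<in> borel_measurable reference_measure"
    by (rule measurable_cong[THEN iffD1, OF eq \<rho>'])
  have "\<mu> = density reference_measure ?\<rho>"
    unfolding C(2) by (rule density_cong[OF \<rho>' \<rho> AE_I2[OF eq]])
  moreover from this have "absolutely_continuous reference_measure \<mu>"
    using absolutely_continuousI_density[OF \<rho>] by simp
  ultimately show ?thesis using C(1) by blast
qed

end
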